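(* For all Young diagrams $\lambda$ and all $l\in\mathbb{Z}_{\ge1}$, $$\mathfrak{E}\,\mathbb{F}^*_\lambda(\theta_1,\dots,\theta_l)=q^{-\lambda_1}\,\mathbb{F}^*_\lambda(\theta_1,\dots,\theta_l),$$ where $$\mathfrak{E}=\sum_{j=1}^l\Bigl(1+\frac{s}{\theta_j}\Bigr)^l\Bigl(\prod_{i\ne j}\frac{\theta_j}{\theta_j-\theta_i}\Bigr)T_{q^{-1},\theta_j}+\frac{(-s)^l}{\theta_1\cdots\theta_l}\,Id$$ acts on rational functions in $(\theta_1,\dots,\theta_l)$, $T_{q^{-1},\theta_j}$ replaces $\theta_j$ by $\theta_j/q$, and $Id$ is the identity operator.
   Context: $q\in(0,1)$ and $s$ is a generic complex parameter. $(a;q)_0=1$, $(a;q)_k=\prod_{i=1}^k(1-aq^{i-1})$. Young diagrams $\lambda=(\lambda_1\ge\lambda_2\ge\dots\ge0)$ have finitely many nonzero parts. Write $\mu\prec\lambda$ if $\lambda_1\ge\mu_1\ge\lambda_2\ge\mu_2\ge\cdots$. Dual spin $q$-Whittaker polynomials $\mathbb{F}^*_\lambda$: the one-variable skew polynomial is $\mathbb{F}^*_{\lambda/\mu}(\theta)=0$ unless $\mu\prec\lambda$, and for $\mu\prec\lambda$ it is $$\mathbb{F}^*_{\lambda/\mu}(\theta)=\prod_{k\ge1}\theta^{\lambda_k-\mu_k}\frac{(-s/\theta;q)_{\lambda_k-\mu_k}}{(q;q)_{\lambda_k-\mu_k}}\cdot\frac{(-s\theta;q)_{\mu_k-\lambda_{k+1}}}{(q;q)_{\mu_k-\lambda_{k+1}}}\cdot\frac{(q;q)_{\mu_k-\mu_{k+1}}}{(s^2;q)_{\mu_k-\mu_{k+1}}}.$$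 The multivariable polynomials are given by the branching rule $\mathbb{F}^*_{\lambda/\mu}(\theta_1,\dots,\theta_l)=\sum_{\varkappa}\mathbb{F}^*_{\lambda/\varkappa}(\theta_l)\,\mathbb{F}^*_{\varkappa/\mu}(\theta_1,\dots,\theta_{l-1})$, and $\mathbb{F}^*_\lambda=\mathbb{F}^*_{\lambda/\varnothing}$. They are symmetric polynomials in the $\theta_i$. *)

theory Defs
  imports Complex_Main "HOL-Library.Groups_Big_Fun"
begin

definition qpoch :: "complex \<Rightarrow> complex \<Rightarrow> nat \<Rightarrow> complex" where
  "qpoch a q k = (\<Prod>i=1..k. 1 - a * q ^ (i - 1))"

text \<open>
  Indices of parts and of variables start at 0: the part usually written \<open>\<lambda>\<^sub>k\<close> is
  \<open>lam (k - 1)\<close>, and the variables \<open>\<theta>\<^sub>1, \<dots>, \<theta>\<^sub>l\<close> are \<open>\<theta> 0, \<dots>, \<theta> (l - 1)\<close>.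
\<close>

definition young_diagram :: "(nat \<Rightarrow> nat) \<Rightarrow> bool" where
  "young_diagram lam \<longleftrightarrow> (\<forall>k. lam (Suc k) \<le> lam k) \<and> finite {k. lam k \<noteq> 0}"

definition interlaces :: "(nat \<Rightarrow> nat) \<Rightarrow> (nat \<Rightarrow> nat) \<Rightarrow> bool"  (infix "\<prec>" 50) where
  "mu \<prec> lam \<longleftrightarrow> (\<forall>k. mu k \<le> lam k \<and> lam (Suc k) \<le> mu k)"

text \<open>
  The product over \<open>k\<close> is \<^const>\<open>Prod_any\<close>, the product of the factors different from 1;
  \<open>finite_F1_factors\<close> below shows that there are finitely many of them.
  Because \<open>- s / \<theta>\<close> occurs, the formula is meaningful as written only for \<open>\<theta> \<noteq> 0\<close>.
\<close>

definition F1_factor ::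
  "complex \<Rightarrow> complex \<Rightarrow> (nat \<Rightarrow> nat) \<Rightarrow> (nat \<Rightarrow> nat) \<Rightarrow> complex \<Rightarrow> nat \<Rightarrow> complex" where
  "F1_factor q s lam mu \<theta> k =
     \<theta> ^ (lam k - mu k)
     * (qpoch (- s / \<theta>) q (lam k - mu k) / qpoch q q (lam k - mu k))
     * (qpoch (- s * \<theta>) q (mu k - lam (Suc k)) / qpoch q q (mu k - lam (Suc k)))
     * (qpoch q q (mu k - mu (Suc k)) / qpoch (s\<^sup>2) q (mu k - mu (Suc k)))"

definition F1 ::
  "complex \<Rightarrow> complex \<Rightarrow> (nat \<Rightarrow> nat) \<Rightarrow> (nat \<Rightarrow> nat) \<Rightarrow> complex \<Rightarrow> complex" where
  "F1 q s lam mu \<theta> = (if mu \<prec> lam then \<Prod>k. F1_factor q s lam mu \<theta> k else 0)"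

text \<open>
  The branching rule. Zero variables give the Kronecker delta, so that one variable gives
  \<^const>\<open>F1\<close> (\<open>F_skew_one\<close> below). Summing only over \<open>\<kappa> \<prec> \<lambda>\<close> drops terms in which the
  one-variable factor vanishes, and makes the sum finite (\<open>finite_interlacing\<close> below).
\<close>

primrec F_skew ::
  "complex \<Rightarrow> complex \<Rightarrow> nat \<Rightarrow> (nat \<Rightarrow> nat) \<Rightarrow> (nat \<Rightarrow> nat) \<Rightarrow> (nat \<Rightarrow> complex) \<Rightarrow> complex" where
  "F_skew q s 0 lam mu \<theta> = (if lam = mu then 1 else 0)"
| "F_skew q s (Suc l) lam mu \<theta> =
     (\<Sum>\<kappa> | young_diagram \<kappa> \<and> \<kappa> \<prec> lam. F1 q s lam \<kappa> (\<theta> l) * F_skew q s l \<kappa> mu \<theta>)"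

definition dual_spin_qW ::
  "complex \<Rightarrow> complex \<Rightarrow> nat \<Rightarrow> (nat \<Rightarrow> nat) \<Rightarrow> (nat \<Rightarrow> complex) \<Rightarrow> complex" where
  "dual_spin_qW q s l lam = F_skew q s l lam (\<lambda>_. 0)"

definition T_qinv ::
  "complex \<Rightarrow> nat \<Rightarrow> ((nat \<Rightarrow> complex) \<Rightarrow> complex) \<Rightarrow> (nat \<Rightarrow> complex) \<Rightarrow> complex" where
  "T_qinv q j f = (\<lambda>\<theta>. f (\<theta>(j := \<theta> j / q)))"

text \<open>
  A rational function in the \<open>\<theta>\<^sub>j\<close> is represented by its values. The coefficients of the operator
  are regular exactly where the \<open>\<theta>\<^sub>j\<close> are nonzero and pairwise distinct.
\<close>

definition E_op ::
  "complex \<Rightarrow> complex \<Rightarrow> nat \<Rightarrow> ((nat \<Rightarrow> complex) \<Rightarrow> complex) \<Rightarrow> (nat \<Rightarrow> complex) \<Rightarrow> complex" where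
  "E_op q s l f = (\<lambda>\<theta>.
     (\<Sum>j<l. (1 + s / \<theta> j) ^ l * (\<Prod>i\<in>{..<l} - {j}. \<theta> j / (\<theta> j - \<theta> i)) * T_qinv q j f \<theta>)
     + (- s) ^ l / (\<Prod>j<l. \<theta> j) * f \<theta>)"

lemma finite_interlacing:
  assumes "young_diagram lam"
  shows "finite {mu. mu \<prec> lam}"
proof -
  let ?A = "{k. lam k \<noteq> 0}"
  have fin: "finite ?A" using assms by (simp add: young_diagram_def)
  have "{mu. mu \<prec> lam} \<subseteq>
      {f. \<forall>x. (x \<in> ?A \<longrightarrow> f x \<in> {..Max (lam ` ?A)}) \<and> (x \<notin> ?A \<longrightarrow> f x = 0)}"
  proof (intro subsetI CollectI allI conjI impI)
    fix mu x assume "mu \<in> {mu. mu \<prec> lam}"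
    then have le: "mu x \<le> lam x" by (simp add: interlaces_def)
    show "mu x \<in> {..Max (lam ` ?A)}" if "x \<in> ?A"
    proof -
      have "lam x \<le> Max (lam ` ?A)" using fin that by (intro Max_ge) auto
      with le show ?thesis by simp
    qed
    show "mu x = 0" if "x \<notin> ?A" using le that by simp
  qed
  moreover have "finite {f. \<forall>x. (x \<in> ?A \<longrightarrow> f x \<in> {..Max (lam ` ?A)}) \<and> (x \<notin> ?A \<longrightarrow> f x = 0)}"
    by (rule finite_set_of_finite_funs[OF fin]) simp
  ultimately show ?thesis by (rule finite_subset)
qed

lemma interlaces_young_diagram:
  assumes "young_diagram lam" "mu \<prec> lam"
  shows "young_diagram mu"
proof -
  have "{k. mu k \<noteq> 0} \<subseteq> {k. lam k \<noteq> 0}"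
    using assms(2) by (auto simp: interlaces_def) (metis not_gr_zero not_less)
  then have "finite {k. mu k \<noteq> 0}"
    using assms(1) finite_subset unfolding young_diagram_def by blast
  then show ?thesis
    using assms(2) unfolding young_diagram_def interlaces_def by (meson le_trans)
qed

lemma finite_F1_factors:
  assumes "young_diagram lam" "mu \<prec> lam"
  shows "finite {k. F1_factor q s lam mu \<theta> k \<noteq> 1}"
proof (rule finite_subset)
  show "finite {k. lam k \<noteq> 0}" using assms by (simp add: young_diagram_def)
  show "{k. F1_factor q s lam mu \<theta> k \<noteq> 1} \<subseteq> {k. lam k \<noteq> 0}"
  proof (rule ccontr)
    assume "\<not> ?thesis"
    then obtain k where k: "F1_factor q s lam mu \<theta> k \<noteq> 1" "lam k = 0" by blast
    have "mu k = 0" using assms(2) k(2) by (metis interlaces_def le_zero_eq)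
    with k show False by (simp add: F1_factor_def qpoch_def)
  qed
qed

lemma F_skew_one:
  assumes "young_diagram lam" "young_diagram mu"
  shows "F_skew q s 1 lam mu \<theta> = F1 q s lam mu (\<theta> 0)"
proof -
  have fin: "finite {\<kappa>. young_diagram \<kappa> \<and> \<kappa> \<prec> lam}"
    by (rule finite_subset[OF _ finite_interlacing[OF assms(1)]]) blast
  have "F_skew q s 1 lam mu \<theta> =
      (\<Sum>\<kappa> | young_diagram \<kappa> \<and> \<kappa> \<prec> lam. if \<kappa> = mu then F1 q s lam mu (\<theta> 0) else 0)"
    unfolding One_nat_def F_skew.simps by (rule sum.cong) auto
  also have "\<dots> = F1 q s lam mu (\<theta> 0)"
    using assms(2) by (simp only: sum.delta[OF fin]) (auto simp: F1_def)
  finally show ?thesis .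
qed

end

theory Submission
  imports Defs "HOL-Computational_Algebra.Polynomial"
begin

text \<open>
  The operator \<open>E\<close> is Lagrange's formula for a leading coefficient. On functions of
  partitions with at most \<open>l\<close> parts there are operators \<open>A\<^sub>0(z)\<close> and \<open>A\<^sub>1(z)\<close>, entries of the
  monodromy matrix of a vertex model with two-dimensional auxiliary space, which raise each part
  by 0 or 1 (the first part by \<open>i\<close> in \<open>A\<^sub>i\<close>). The operator \<open>A\<^sub>0(z)\<close> is a polynomial in \<open>z\<close> of
  degree \<open>l\<close>; its constant and leading coefficients are the diagonal operators \<open>s^l\<close> and
  \<open>q^(-\<lambda>\<^sub>1)\<close>. A Yang-Baxter type exchange relation with the one-variable branching operator gives,
  by induction on the number of variables, \<open>A\<^sub>i(\<theta>\<^sub>j) F = q^(-i) (\<theta>\<^sub>j + s)^l T\<^sub>j F\<close> for every \<open>j\<close>,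
  where \<open>T\<^sub>j\<close> divides \<open>\<theta>\<^sub>j\<close> by \<open>q\<close>. Interpolating \<open>A\<^sub>0(z) F\<close> at \<open>0, \<theta>\<^sub>1, \<dots>, \<theta>\<^sub>l\<close> and comparing
  coefficients of \<open>z^l\<close> yields the eigenrelation; the node 0 produces the multiple of the identity.
\<close>

section \<open>q-Pochhammer symbols and Lagrange interpolation\<close>

lemma qpoch_Suc: "qpoch a q (Suc k) = qpoch a q k * (1 - a * q ^ k)"
  by (simp add: qpoch_def prod.atLeast_Suc_atMost_Suc_shift flip: atLeastLessThanSuc_atLeastAtMost)

text \<open>Each basis polynomial \<open>b x\<close> is monic of degree \<open>card S - 1\<close>,
  so the top coefficient of the interpolation formula is the sum of the weights
  \<open>c x\<close>.\<close>

lemma coeff_lagrange: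
  fixes p :: "complex poly"
  assumes "finite S" "degree p < card S"
  shows "coeff p (card S - 1) = (\<Sum>x\<in>S. poly p x / (\<Prod>y\<in>S - {x}. x - y))"
proof -
  define c where "c x = poly p x / (\<Prod>y\<in>S - {x}. x - y)" for x
  define b where "b x = (\<Prod>y\<in>S - {x}. [:- y, 1:])" for x :: complex
  have deg: "degree (b x) = card S - 1" and lead: "coeff (b x) (card S - 1) = 1" if "x \<in> S" for x
  proof -
    show d: "degree (b x) = card S - 1"
      unfolding b_def using that assms(1) by (subst degree_prod_sum_eq) (auto simp: card_Diff_singleton)
    have "lead_coeff (b x) = 1" unfolding b_def by (simp add: lead_coeff_prod)
    then show "coeff (b x) (card S - 1) = 1" by (simp add: d)
  qed
  have "p = (\<Sum>x\<in>S. smult (c x) (b x))"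
  proof (rule poly_eqI_degree[of S])
    fix x assume x: "x \<in> S"
    have "poly (b y) x = 0" if "y \<in> S" "y \<noteq> x" for y
      using that x assms(1) by (auto simp: b_def poly_prod)
    then have "poly (\<Sum>y\<in>S. smult (c y) (b y)) x = (\<Sum>y\<in>S. if y = x then c x * poly (b x) x else 0)"
      unfolding poly_sum by (intro sum.cong) auto
    also have "\<dots> = c x * (\<Prod>y\<in>S - {x}. x - y)"
      using x assms(1) by (simp add: b_def poly_prod)
    also have "\<dots> = poly p x"
      using assms(1) by (auto simp: c_def)
    finally show "poly p x = poly (\<Sum>y\<in>S. smult (c y) (b y)) x" ..
  next
    have "degree (\<Sum>x\<in>S. smult (c x) (b x)) \<le> card S - 1"
      by (intro degree_sum_le assms) (auto simp: deg intro: order.trans[OF degree_smult_le])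
    then show "degree (\<Sum>x\<in>S. smult (c x) (b x)) < card S" using assms(2) by linarith
  qed (rule assms)
  then have "coeff p (card S - 1) = coeff (\<Sum>x\<in>S. smult (c x) (b x)) (card S - 1)" by simp
  also have "\<dots> = (\<Sum>x\<in>S. c x)" by (simp add: coeff_sum lead del: One_nat_def)
  finally show ?thesis by (simp add: c_def)
qed

section \<open>The one-site exchange relation as polynomial identities\<close>

text \<open>The content of \<open>local_intertwining\<close> as ring algebra: \<open>A\<close>,
  \<open>B\<close> stand for the powers of \<open>q\<close> with exponents a and b, primes for
  inverses, \<open>C'\<close> for the inverse power with exponent c, \<open>p\<close> for
  \<open>1 / q\<close>; \<open>f0\<close>, \<open>f1\<close> are \<open>phi\<close> at a and a + 1,
  and \<open>g0\<close>, \<open>g1\<close> are \<open>psi\<close> at b and b - 1. The conclusions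
  are the entries (0,0), (0,1), (1,0), (1,1).\<close>

lemma local_intertwining_ring:
  fixes A B A' B' C' q p s w z f0 f1 g0 g1 :: complex
  assumes inv: "A' * A = 1" "B' * B = 1" "p * q = 1"
    and f: "(\<exists>P. f0 = P * (1 - q * A) \<and> f1 = P * (w + s * A)) \<or> (f0 = 0 \<and> A' = q)"
    and g: "(\<exists>R. g1 = R * (1 - B) \<and> g0 = R * (1 + s * w * B * p)) \<or> (g1 = 0 \<and> B' = 1)"
  shows "(s + z * (A' * B')) * f0 * g0 * (s + z * C') + z * (s\<^sup>2 - q * A' * B') * f0 * g1 * ((s + w * C') * p) =
      f0 * g0 * (s + z * A') * (s + z * (B' * C')) + f1 * g1 * (q * z * (1 - A' * p)) * (B' * C' - s\<^sup>2 * p)" (is ?g00)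
    and "(s + z * (A' * B')) * f0 * g0 * (q * z * (1 - C')) + z * (s\<^sup>2 - q * A' * B') * f0 * g1 * (z - w * C') =
      f0 * g0 * (s + z * A') * (z * (q - q * B' * C')) + f1 * g1 * (q * z * (1 - A' * p)) * - (z * s + q * B' * C')" (is ?g01)
    and "(A' * B' * p - 1) * f1 * g0 * (s + z * C') + - (z * s + A' * B') * f1 * g1 * ((s + w * C') * p) =
      f0 * g0 * ((s + w * A') * p) * (s + z * (B' * C')) + f1 * g1 * (z - w * (A' * p)) * (B' * C' - s\<^sup>2 * p)" (is ?g10)
    and "(A' * B' * p - 1) * f1 * g0 * (q * z * (1 - C')) + - (z * s + A' * B') * f1 * g1 * (z - w * C') =
      f0 * g0 * ((s + w * A') * p) * (z * (q - q * B' * C')) + f1 * g1 * (z - w * (A' * p)) * - (z * s + q * B' * C')" (is ?g11)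
proof -
  have "?g00 \<and> ?g01 \<and> ?g10 \<and> ?g11"
    using f
  proof (elim disjE exE conjE)
    fix P assume f: "f0 = P * (1 - q * A)" "f1 = P * (w + s * A)"
    show ?thesis using g
    proof (elim disjE exE conjE)
      fix R assume g: "g1 = R * (1 - B)" "g0 = R * (1 + s * w * B * p)"
      show ?thesis unfolding f g using inv by (intro conjI; algebra)
    next
      assume g: "g1 = 0" "B' = 1"
      \<comment> \<open>As \<open>g1 = 0\<close> and \<open>B' = 1\<close>, the first two entries
        are trivial and the other two reduce to the single identity \<open>key\<close>.\<close>
      have "A' * A = 1" "p * q = 1" using inv by auto
      then have key: "(A' * p - 1) * (w + s * A) = (1 - q * A) * ((s + w * A') * p)" by algebra
      have "(A' * p - 1) * (P * (w + s * A)) * g0 * X = P * (1 - q * A) * g0 * ((s + w * A') * p) * X" for X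
        using key by algebra
      from this[of "s + z * C'"] this[of "q * z * (1 - C')"] show ?thesis
        unfolding f g by (simp add: algebra_simps)
    qed
  next
    assume f: "f0 = 0" "A' = q"
    have q: "q * p = 1" using inv by (simp add: mult.commute)
    show ?thesis using g
    proof (elim disjE exE conjE)
      fix R assume g: "g1 = R * (1 - B)" "g0 = R * (1 + s * w * B * p)"
      show ?thesis unfolding f g q using inv(2) q
        by (intro conjI; (simp; fail)?; algebra)
    next
      assume "g1 = 0" "B' = 1"
      then show ?thesis using q by (simp add: f)
    qed
  qed
  then show ?g00 ?g01 ?g10 ?g11 by blast+
qed

section \<open>Parameters, weights and operators\<close>

text \<open>The last two conditions keep \<open>qpoch q q k\<close> and
  \<open>qpoch (s\<^sup>2) q k\<close> away from zero.\<close>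

locale spin_parameters =
  fixes q s :: complex
  assumes q_nonzero: "q \<noteq> 0"
    and q_not_root_of_unity: "\<And>n. 0 < n \<Longrightarrow> q ^ n \<noteq> 1"
    and s_generic: "\<And>n. s\<^sup>2 * q ^ n \<noteq> 1"
begin

definition chi :: "nat \<Rightarrow> complex" where
  "chi m = qpoch q q m / qpoch (s\<^sup>2) q m"

text \<open>At nonnegative arguments and \<open>w \<noteq> 0\<close> this is the first quotient of
  \<open>F1_factor\<close> together with its power of the variable (\<open>phi_of_nat\<close>);
  absorbing the power removes the division by \<open>w\<close>. The second quotient is
  \<open>psi\<close>.\<close>

definition phi :: "complex \<Rightarrow> int \<Rightarrow> complex" where
  "phi w a = (if a < 0 then 0 else \<Prod>i<nat a. (w + s * q ^ i) / (1 - q ^ Suc i))"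

definition psi :: "complex \<Rightarrow> int \<Rightarrow> complex" where
  "psi w b = (if b < 0 then 0 else \<Prod>i<nat b. (1 + s * w * q ^ i) / (1 - q ^ Suc i))"

text \<open>
  Partitions with at most \<open>l\<close> parts are lists of length \<open>l\<close>, padded by zeros. Summing \<open>f\<close> against the
  one-variable skew polynomials gives \<open>branch\<close> up to moving the factors \<open>chi\<close> from the inner partition
  to the outer one, which makes \<open>hop_wt\<close> below free of denominators involving \<open>s\<close>. Both \<open>phi\<close>
  and \<open>psi\<close> vanish at negative arguments, so interlacing need not be imposed on the sum.
\<close>

fun branch :: "complex \<Rightarrow> nat list \<Rightarrow> (nat list \<Rightarrow> complex) \<Rightarrow> complex" where
  "branch w [] f = 0"
| "branch w [x] f = chi x * phi w x * f []"
| "branch w (x # y # lam) f = chi (x - y) *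
     (\<Sum>u\<le>x. phi w (int x - int u) * psi w (int u - int y) * branch w (y # lam) (\<lambda>\<kappa>. f (u # \<kappa>)))"

definition hd0 :: "nat list \<Rightarrow> int" where
  "hd0 lam = (case lam of [] \<Rightarrow> 0 | x # _ \<Rightarrow> int x)"

lemma hd0_simps [simp]: "hd0 [] = 0" "hd0 (x # lam) = int x"
  by (simp_all add: hd0_def)

text \<open>
  \<open>hop_wt z i j m\<close> is the weight of a vertex with auxiliary state \<open>i\<close> on the left and \<open>j\<close> on the
  right, at a site occupied by \<open>m = \<lambda>\<^sub>k - \<lambda>\<^bsub>k+1\<^esub>\<close> particles; \<open>hop_wt'\<close> is its conjugate by \<open>chi\<close>,
  see \<open>chi_hop_wt\<close>.
\<close>

definition hop_wt :: "complex \<Rightarrow> nat \<Rightarrow> nat \<Rightarrow> int \<Rightarrow> complex" where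
  "hop_wt z i j m =
     (if i = 0 then if j = 0 then s + z * q powi (- m) else z * (q - q powi (1 - m))
      else if j = 0 then q powi (- m - 1) - s\<^sup>2 / q else - (z * s + q powi (- m)))"

definition hop_wt' :: "complex \<Rightarrow> nat \<Rightarrow> nat \<Rightarrow> int \<Rightarrow> complex" where
  "hop_wt' z i j m =
     (if i = 0 then if j = 0 then s + z * q powi (- m) else z * (s\<^sup>2 - q powi (1 - m))
      else if j = 0 then q powi (- m - 1) - 1 else - (z * s + q powi (- m)))"

text \<open>
  The exchange matrix plays the role of the R-matrix; \<open>a\<close> is the horizontal flow
  \<open>\<lambda>\<^sub>k - \<kappa>\<^sub>k\<close> through the branching operator.
\<close>

definition exchange :: "complex \<Rightarrow> complex \<Rightarrow> int \<Rightarrow> nat \<Rightarrow> nat \<Rightarrow> complex" where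
  "exchange z w a i j =
     (if i = 0 then if j = 0 then s + z * q powi (- a) else q * z * (1 - q powi (- a))
      else if j = 0 then (s + w * q powi (- a)) / q else z - w * q powi (- a))"

text \<open>This is \<open>A\<^sub>i(z)\<close>. The auxiliary line enters at the first part in
  state \<open>i\<close>, raises each part by the state in which it arrives there, and must end in
  state 0. Since \<open>hop_wt z 0 1 0 = 0\<close>, no part overtakes the one before it.\<close>

fun hop :: "complex \<Rightarrow> nat \<Rightarrow> nat list \<Rightarrow> (nat list \<Rightarrow> complex) \<Rightarrow> complex" where
  "hop z i [] f = (if i = 0 then f [] else 0)"
| "hop z i (x # lam) f =
     (\<Sum>j\<le>1. hop_wt z i j (int x - hd0 lam) * hop z j lam (\<lambda>\<nu>. f ((x + i) # \<nu>)))"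

section \<open>Recurrences and the one-site exchange relation\<close>

lemma powi_not_1: "0 < n \<Longrightarrow> q powi n \<noteq> 1"
  using q_not_root_of_unity[of "nat n"] by (simp add: power_int_def)

text \<open>Valid at all integers: at a = -1, where \<open>phi\<close> jumps from 0 to 1, the factor
  \<open>1 - q powi 0\<close> vanishes. The same happens in \<open>psi_rec\<close> at b = 0.\<close>

lemma phi_rec: "phi w (a + 1) * (1 - q powi (a + 1)) = (w + s * q powi a) * phi w a"
proof -
  consider "a < -1" | "a = -1" | "a \<ge> 0" by linarith
  then show ?thesis
  proof cases
    case 3
    then obtain n where n: "a = int n" using nonneg_int_cases by blast
    have "q powi (int n + 1) = q ^ Suc n" by (metis of_nat_Suc add.commute power_int_of_nat)
    moreover have "nat (int n + 1) = Suc n" by simp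
    ultimately show ?thesis using q_not_root_of_unity[of "Suc n"]
      by (simp add: n phi_def del: power_Suc)
  qed (auto simp: phi_def)
qed

lemma psi_rec: "psi w b * (1 - q powi b) = (1 + s * w * q powi (b - 1)) * psi w (b - 1)"
proof -
  consider "b < 0" | "b = 0" | "b > 0" by linarith
  then show ?thesis
  proof cases
    case 3
    define n where "n = nat (b - 1)"
    with 3 have n: "b = int n + 1" by simp
    have "q powi (int n + 1) = q ^ Suc n" by (metis of_nat_Suc add.commute power_int_of_nat)
    moreover have "nat (int n + 1) = Suc n" by simp
    ultimately show ?thesis using q_not_root_of_unity[of "Suc n"]
      by (simp add: n psi_def field_simps del: power_Suc)
  qed (auto simp: psi_def)
qed

text \<open>
  These two case distinctions parametrize neighbouring values of \<open>phi\<close> and \<open>psi\<close> without dividing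
  by them, since either may vanish at special values of \<open>w\<close>.
\<close>

lemma phi_cases:
  obtains (generic) P where "phi w a = P * (1 - q * q powi a)" "phi w (a + 1) = P * (w + s * q powi a)"
  | (edge) "a = -1" "phi w a = 0"
proof (cases "a = -1")
  case True
  then show ?thesis using edge by (simp add: phi_def)
next
  case False
  show ?thesis
  proof (cases "a < 0")
    case True
    with False have "phi w a = 0" "phi w (a + 1) = 0" by (auto simp: phi_def)
    then show ?thesis using generic[of 0] by simp
  next
    case False
    have q: "q powi (a + 1) = q * q powi a" using q_nonzero by (simp add: power_int_add)
    have "1 - q * q powi a \<noteq> 0" using powi_not_1[of "a + 1"] False q by auto
    then show ?thesis using generic[of "phi w a / (1 - q * q powi a)"] phi_rec[of w a]
      unfolding q by (simp add: field_simps)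
  qed
qed

lemma psi_cases:
  obtains (generic) R where "psi w (b - 1) = R * (1 - q powi b)" "psi w b = R * (1 + s * w * q powi b / q)"
  | (edge) "b = 0" "psi w (b - 1) = 0"
proof (cases "b = 0")
  case True
  then show ?thesis using edge by (simp add: psi_def)
next
  case False
  show ?thesis
  proof (cases "b < 0")
    case True
    then have "psi w b = 0" "psi w (b - 1) = 0" by (auto simp: psi_def)
    then show ?thesis using generic[of 0] by simp
  next
    case False
    have q: "q powi (b - 1) = q powi b / q" using q_nonzero by (simp add: power_int_diff)
    have "1 - q powi b \<noteq> 0" using powi_not_1[of "b"] False \<open>b \<noteq> 0\<close> by auto
    then show ?thesis using generic[of "psi w (b - 1) / (1 - q powi b)"] psi_rec[of w b]
      unfolding q by (simp add: field_simps)
  qed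
qed

lemma sum_le_1: "(\<Sum>j\<le>1. f j) = f 0 + f (1::nat)" for f :: "nat \<Rightarrow> complex"
  by simp

text \<open>One-site Yang-Baxter relation. For outer parts x, y and inner parts u, v put a = x - u,
  b = u - y, c = y - v. On the left the outer parts hop and the exchange matrix stands to the right
  of the vertex; on the right it stands to the left and the inner part hops from u - j to u.\<close>

lemma local_intertwining:
  assumes "i \<le> 1" "k \<le> 1"
  shows "(\<Sum>j\<le>1. hop_wt' z i j (a + b) * phi w (a + int i) * psi w (b - int j) * exchange z w c j k) =
    (\<Sum>j\<le>1. phi w (a + int j) * psi w (b - int j) * exchange z w (a + int j) i j * hop_wt z j k (b - int j + c))"
proof -
  define A B A' B' C' p
    where "A = q powi a" and "B = q powi b"
      and "A' = inverse A" and "B' = inverse B" and "C' = inverse (q powi c)" and "p = inverse q"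
  note defs = A_def B_def A'_def B'_def C'_def p_def
  have nz: "A \<noteq> 0" "B \<noteq> 0" using q_nonzero by (auto simp: defs)
  have inv: "A' * A = 1" "B' * B = 1" "p * q = 1" using q_nonzero nz by (auto simp: defs)
  have pw: "q powi (- a) = A'" "q powi (- c) = C'" "q powi (- (a + b)) = A' * B'"
    "q powi (1 - (a + b)) = q * A' * B'" "q powi (- (a + b) - 1) = A' * B' * p"
    "q powi (- (a + 1)) = A' * p" "q powi (- (b + c)) = B' * C'"
    "q powi (1 - (b + c)) = q * B' * C'" "q powi (- (b + c) - 1) = B' * C' * p"
    "q powi (- (b - 1 + c)) = q * B' * C'" "q powi (1 - (b - 1 + c)) = q^2 * B' * C'"
    "q powi (- (b - 1 + c) - 1) = B' * C'"
    using q_nonzero by (simp_all add: defs power_int_add power_int_diff power_int_minus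
        field_simps power2_eq_square)
  have ik: "(i = 0 \<or> i = 1) \<and> (k = 0 \<or> k = 1)" using assms by auto
  have phi: "(\<exists>P. phi w a = P * (1 - q * A) \<and> phi w (a + 1) = P * (w + s * A)) \<or>
      (phi w a = 0 \<and> A' = q)"
    by (cases rule: phi_cases[of w a]) (auto simp: defs)
  have psi: "(\<exists>R. psi w (b - 1) = R * (1 - B) \<and> psi w b = R * (1 + s * w * B * p)) \<or>
      (psi w (b - 1) = 0 \<and> B' = 1)"
    by (cases rule: psi_cases[of w b]) (auto simp: defs field_simps)
  have p: "x / q = x * p" for x by (simp add: p_def divide_inverse)
  note ring = local_intertwining_ring[OF inv phi psi]
  note unf = sum_le_1 hop_wt_def hop_wt'_def exchange_def simp_thms if_True if_False zero_neq_one one_neq_zero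
      of_nat_0 of_nat_1 add_0_right diff_zero pw p
  from ik consider "i = 0" "k = 0" | "i = 0" "k = 1" | "i = 1" "k = 0" | "i = 1" "k = 1" by auto
  then show ?thesis
    by cases (simp_all only: unf ring)
qed

section \<open>Degeneration at equal spectral parameters\<close>

text \<open>Dividing \<open>w\<close> by \<open>q\<close> turns \<open>w + s * q ^ i\<close> into
  \<open>(w + s * q ^ (i + 1)) / q\<close>, so the numerator moves by one index and
  \<open>w + s\<close> restores the missing first factor.\<close>

lemma phi_shift: "(w + s) * phi (w / q) a = q powi (- a) * (w + s * q powi a) * phi w a"
proof (cases "a < 0")
  case True
  then show ?thesis by (simp add: phi_def)
next
  case False
  then obtain n where n: "a = int n" using nonneg_int_cases[of a] by auto
  have "(w + s) * phi (w / q) (int n) = (w + s * q ^ n) / q ^ n * phi w (int n)"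
  proof (induction n)
    case 0
    then show ?case by (simp add: phi_def)
  next
    case (Suc n)
    have "phi v (int (Suc n)) = phi v (int n) * ((v + s * q ^ n) / (1 - q ^ Suc n))" for v
      by (simp add: phi_def nat_add_distrib del: power_Suc)
    then have "(w + s) * phi (w / q) (int (Suc n)) =
        ((w + s) * phi (w / q) (int n)) * ((w / q + s * q ^ n) / (1 - q ^ Suc n))"
      and "phi w (int (Suc n)) = phi w (int n) * ((w + s * q ^ n) / (1 - q ^ Suc n))"
      by simp_all
    then show ?case unfolding Suc.IH
      using q_nonzero by (simp add: field_simps)
  qed
  then show ?thesis unfolding n by (simp add: power_int_minus divide_inverse mult_ac)
qed

text \<open>Here the index moves down: the numerator gains the first factor
  \<open>1 + s * w / q\<close> and loses its last one.\<close>

lemma psi_shift: "psi (w / q) b * (1 - q powi b) = (1 + s * w / q) * psi w (b - 1)"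
proof -
  consider "b < 0" | "b = 0" | "b > 0" by linarith
  then show ?thesis
  proof cases
    case 3
    define n where "n = nat (b - 1)"
    with 3 have n: "b = int (Suc n)" by simp
    have "psi (w / q) (int (Suc n)) * (1 - q ^ Suc n) = (1 + s * w / q) * psi w (int n)"
    proof (induction n)
      case 0
      then show ?case using q_not_root_of_unity[of 1] by (simp add: psi_def)
    next
      case (Suc n)
      have psi: "psi v (int (Suc n)) = psi v (int n) * ((1 + s * v * q ^ n) / (1 - q ^ Suc n))" for v n
        by (simp add: psi_def nat_add_distrib del: power_Suc)
      have nz: "1 - q ^ Suc n \<noteq> 0" "1 - q ^ Suc (Suc n) \<noteq> 0"
        using q_not_root_of_unity[of "Suc n"] q_not_root_of_unity[of "Suc (Suc n)"] by auto
      have "psi (w / q) (int (Suc (Suc n))) * (1 - q ^ Suc (Suc n)) =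
          psi (w / q) (int (Suc n)) * (1 + s * w * q ^ n)"
        unfolding psi[of _ "Suc n"] using nz q_nonzero by simp
      also have "\<dots> = (psi (w / q) (int (Suc n)) * (1 - q ^ Suc n)) * ((1 + s * w * q ^ n) / (1 - q ^ Suc n))"
        using nz by simp
      finally show ?case unfolding Suc.IH psi[of w n] by simp
    qed
    moreover have "b - 1 = int n" using n by simp
    ultimately show ?thesis by (simp only: n power_int_of_nat)
  qed (auto simp: psi_def)
qed

text \<open>At z = w, the vector \<open>(1, 1 / q)\<close> attached on the right reappears on the
  left, multiplied by the branching weights at \<open>w / q\<close>. This is where the shift
  operator comes from.\<close>

lemma local_degeneration:
  assumes "i \<le> 1"
  shows "(\<Sum>j\<le>1. hop_wt' w i j (a + b) * phi w (a + int i) * psi w (b - int j) * (1 / q) ^ j) =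
    (1 / q) ^ i * (w + s) * (phi (w / q) a * psi (w / q) b)"
proof -
  define A B A' B' p
    where "A = q powi a" and "B = q powi b"
      and "A' = inverse A" and "B' = inverse B" and "p = inverse q"
  note defs = A_def B_def A'_def B'_def p_def
  have nz: "A \<noteq> 0" "B \<noteq> 0" using q_nonzero by (auto simp: defs)
  have inv: "A' * A = 1" "B' * B = 1" "p * q = 1" using q_nonzero nz by (auto simp: defs)
  have pw: "q powi (- (a + b)) = A' * B'"
    "q powi (1 - (a + b)) = q * A' * B'" "q powi (- (a + b) - 1) = A' * B' * p"
    using q_nonzero by (simp_all add: defs power_int_add power_int_diff power_int_minus
        field_simps power2_eq_square)
  have phi: "(\<exists>P. phi w a = P * (1 - q * A) \<and> phi w (a + 1) = P * (w + s * A)) \<or>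
      (phi w a = 0 \<and> A' = q)"
    by (cases rule: phi_cases[of w a]) (auto simp: defs)
  \<comment> \<open>The shifted value \<open>psi (w / q) b\<close> must be expressed by the same
    \<open>R\<close> as the two values in \<open>psi_cases\<close>; for \<open>b \<noteq> 0\<close>
    one can divide by \<open>1 - B\<close>.\<close>
  have psi: "(\<exists>R. psi w (b - 1) = R * (1 - B) \<and> psi w b = R * (1 + s * w * B * p) \<and>
        psi (w / q) b = R * (1 + s * w * p)) \<or>
      (psi w (b - 1) = 0 \<and> psi (w / q) b = psi w b \<and> B' = 1)"
  proof (cases "b = 0")
    case True
    then show ?thesis by (simp add: psi_def defs)
  next
    case False
    then have B: "1 - B \<noteq> 0"
    proof (cases "b > 0")
      case True
      then show ?thesis using powi_not_1[of b] by (simp add: B_def)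
    next
      case False
      then have "q powi (- b) \<noteq> 1" using \<open>b \<noteq> 0\<close> powi_not_1[of "- b"] by simp
      then show ?thesis by (simp add: B_def power_int_minus)
    qed
    have "q powi (b - 1) = B * p" using q_nonzero by (simp add: defs power_int_diff divide_inverse)
    with psi_rec[of w b] psi_shift[of w b]
    have "psi w b * (1 - B) = (1 + s * w * (B * p)) * psi w (b - 1)"
      "psi (w / q) b * (1 - B) = (1 + s * w * p) * psi w (b - 1)"
      by (simp_all add: B_def p_def divide_inverse)
    with B have "psi w b = (psi w (b - 1) / (1 - B)) * (1 + s * w * B * p)"
      "psi (w / q) b = (psi w (b - 1) / (1 - B)) * (1 + s * w * p)"
      by (simp_all add: eq_divide_eq mult_ac)
    with B show ?thesis by (intro disjI1 exI[of _ "psi w (b - 1) / (1 - B)"]) simp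
  qed
  have shift: "(w + s) * phi (w / q) a = A' * (w + s * A) * phi w a"
    using phi_shift[of w a] by (simp add: defs power_int_minus)
  have "(s + w * (A' * B')) * phi w a * psi w b + w * (s\<^sup>2 - q * A' * B') * phi w a * psi w (b - 1) * p =
      A' * (w + s * A) * phi w a * psi (w / q) b \<and>
    (A' * B' * p - 1) * phi w (a + 1) * psi w b + - (w * s + A' * B') * phi w (a + 1) * psi w (b - 1) * p =
      p * (A' * (w + s * A) * phi w a) * psi (w / q) b"
    using phi psi
  proof (elim disjE exE conjE)
    fix P R
    assume f: "phi w a = P * (1 - q * A)" "phi w (a + 1) = P * (w + s * A)"
      and g: "psi w (b - 1) = R * (1 - B)" "psi w b = R * (1 + s * w * B * p)"
        "psi (w / q) b = R * (1 + s * w * p)"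
    show ?thesis unfolding f g using inv by (intro conjI; algebra)
  next
    fix P
    assume f: "phi w a = P * (1 - q * A)" "phi w (a + 1) = P * (w + s * A)"
      and g: "psi w (b - 1) = 0" "psi (w / q) b = psi w b" "B' = 1"
    have "s + w * A' = A' * (w + s * A)" 
      and "(A' * p - 1) * (w + s * A) = p * (A' * (w + s * A) * (1 - q * A))"
      using inv by algebra+
    then show ?thesis unfolding f g by simp
  next
    fix R
    assume f: "phi w a = 0" "A' = q"
      and g: "psi w (b - 1) = R * (1 - B)" "psi w b = R * (1 + s * w * B * p)"
    \<comment> \<open>For a = -1 the right side is zero, so the two terms on the left have to
      cancel.\<close>
    have "(q * B' * p - 1) * (1 + s * w * B * p) + - (w * s + q * B') * (1 - B) * p = 0"
      using inv by algebra
    then have "phi w (a + 1) * R * ((q * B' * p - 1) * (1 + s * w * B * p) + - (w * s + q * B') * (1 - B) * p) = 0"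
      by simp
    then show ?thesis unfolding f g by (simp add: algebra_simps)
  next
    assume "phi w a = 0" "A' = q" "psi w (b - 1) = 0" "B' = 1"
    then show ?thesis using inv by (simp add: mult.commute)
  qed
  then have ids: "(s + w * (A' * B')) * phi w a * psi w b + w * (s\<^sup>2 - q * A' * B') * phi w a * psi w (b - 1) * p =
      (w + s) * (phi (w / q) a * psi (w / q) b)"
    "(A' * B' * p - 1) * phi w (a + 1) * psi w b + - (w * s + A' * B') * phi w (a + 1) * psi w (b - 1) * p =
      p * (w + s) * (phi (w / q) a * psi (w / q) b)"
    unfolding shift[symmetric] by (simp_all add: mult_ac)
  have p: "1 / q = p" by (simp add: p_def divide_inverse)
  note unf = sum_le_1 hop_wt_def hop_wt'_def simp_thms if_True if_False zero_neq_one one_neq_zero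
      of_nat_0 of_nat_1 add_0_right diff_zero pw p power_0 power_one_right mult_1_right mult_1_left
  from assms consider "i = 0" | "i = 1" by linarith
  then show ?thesis
    by cases (simp_all only: unf ids)
qed

section \<open>Linearity and support of the operators\<close>

lemma hop_sum:
  "hop z j lam (\<lambda>\<nu>. \<Sum>u\<in>A. c u * f u \<nu>) = (\<Sum>u\<in>A. c u * hop z j lam (f u))"
proof (induction lam arbitrary: j f)
  case (Cons x lam)
  show ?case
    unfolding hop.simps Cons.IH sum_distrib_left
    by (subst sum.swap) (simp add: mult_ac)
qed simp

lemma hop_mult: "hop z j lam (\<lambda>\<nu>. c * f \<nu>) = c * hop z j lam f"
  using hop_sum[where A = "{()}" and c = "\<lambda>_. c" and f = "\<lambda>_. f"] by simp

lemma branch_sum: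
  "branch w lam (\<lambda>\<kappa>. \<Sum>k\<in>A. c k * f k \<kappa>) = (\<Sum>k\<in>A. c k * branch w lam (f k))"
proof (induction lam arbitrary: f rule: induct_list012)
  case (2 x)
  then show ?case by (simp add: sum_distrib_left mult_ac)
next
  case (3 x y lam)
  have IH: "branch w (y # lam) (\<lambda>\<kappa>. \<Sum>k\<in>A. c k * f k (u # \<kappa>)) = (\<Sum>k\<in>A. c k * branch w (y # lam) (\<lambda>\<kappa>. f k (u # \<kappa>)))" for u
    using 3(2)[of "\<lambda>k \<kappa>. f k (u # \<kappa>)"] by simp
  have "(\<Sum>u\<le>x. phi w (int x - int u) * psi w (int u - int y) * (\<Sum>k\<in>A. c k * branch w (y # lam) (\<lambda>\<kappa>. f k (u # \<kappa>)))) =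
    (\<Sum>k\<in>A. c k * (\<Sum>u\<le>x. phi w (int x - int u) * psi w (int u - int y) * branch w (y # lam) (\<lambda>\<kappa>. f k (u # \<kappa>))))"
    unfolding sum_distrib_left by (subst sum.swap) (simp add: mult_ac)
  then show ?case by (simp add: IH sum_distrib_left mult_ac)
qed simp

lemma branch_mult: "branch w lam (\<lambda>\<kappa>. c * f \<kappa>) = c * branch w lam f"
  using branch_sum[where A = "{()}" and c = "\<lambda>_. c" and f = "\<lambda>_. f"] by simp

lemma phi_neg: "a < 0 \<Longrightarrow> phi w a = 0" and psi_neg: "b < 0 \<Longrightarrow> psi w b = 0"
  by (simp_all add: phi_def psi_def)

text \<open>Since \<open>psi\<close> removes first entries below \<open>y\<close>, only interlacing
  lists contribute. This lets induction hypotheses about weakly decreasing lists be used under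
  \<open>branch\<close>.\<close>

lemma branch_cong:
  assumes "sorted_wrt (\<ge>) lam"
    and "\<And>\<kappa>. Suc (length \<kappa>) = length lam \<Longrightarrow> sorted_wrt (\<ge>) \<kappa> \<Longrightarrow> hd0 \<kappa> \<le> hd0 lam \<Longrightarrow> f \<kappa> = g \<kappa>"
  shows "branch w lam f = branch w lam g"
  using assms
proof (induction lam arbitrary: f g rule: induct_list012)
  case (3 x y lam)
  have "psi w (int u - int y) * branch w (y # lam) (\<lambda>\<kappa>. f (u # \<kappa>)) =
      psi w (int u - int y) * branch w (y # lam) (\<lambda>\<kappa>. g (u # \<kappa>))" if "u \<le> x" for u
  proof (cases "u < y")
    case True
    then show ?thesis by (simp add: psi_neg)
  next
    case False
    have "f (u # \<kappa>) = g (u # \<kappa>)"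
      if \<kappa>: "Suc (length \<kappa>) = length (y # lam)" "sorted_wrt (\<ge>) \<kappa>" "hd0 \<kappa> \<le> hd0 (y # lam)" for \<kappa>
    proof (rule "3.prems"(2))
      show "sorted_wrt (\<ge>) (u # \<kappa>)"
        using \<kappa>(2,3) False by (cases \<kappa>) auto
    qed (use \<kappa> \<open>u \<le> x\<close> in auto)
    moreover have "sorted_wrt (\<ge>) (y # lam)" using "3.prems"(1) by simp
    ultimately show ?thesis
      using "3.IH"(2)[of "\<lambda>\<kappa>. f (u # \<kappa>)" "\<lambda>\<kappa>. g (u # \<kappa>)"] by simp
  qed
  then show ?case by (auto simp: mult.assoc intro!: sum.cong)
qed auto

section \<open>Conjugation by \<open>chi\<close> and the global exchange relation\<close>

lemma chi_Suc: "chi (Suc n) * (1 - s\<^sup>2 * q ^ n) = chi n * (1 - q * q ^ n)"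
  using s_generic[of n] by (simp add: chi_def qpoch_Suc)

text \<open>The off-diagonal weights differ by the ratio in \<open>chi_Suc\<close>. The factors
  \<open>phi\<close> and \<open>psi\<close> are kept for the case x = y, i = 0, j = 1: there the
  natural-number difference truncates and \<open>hop_wt'\<close> need not vanish, but
  \<open>phi\<close> or \<open>psi\<close> does.\<close>

lemma chi_hop_wt:
  assumes "y \<le> x" "i \<le> 1" "j \<le> 1"
  shows "chi (x + i - (y + j)) * hop_wt z i j (int x - int y) *
      (phi w (int x - int u + int i) * psi w (int u - int y - int j)) =
    chi (x - y) * hop_wt' z i j (int x - int y) *
      (phi w (int x - int u + int i) * psi w (int u - int y - int j))"
proof -
  have pw: "q powi (int n) = q ^ n" "q powi (- int n) = 1 / q ^ n"
    "q powi (- int n - 1) = 1 / (q * q ^ n)" for n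
    using q_nonzero by (simp_all add: power_int_minus power_int_diff divide_inverse)
  consider "i = j" | "i = 0" "j = 1" "x = y" | n where "i = 0" "j = 1" "x = y + Suc n" | "i = 1" "j = 0"
    using assms by (metis One_nat_def add_Suc_right le_Suc_ex le_antisym less_one nat_less_le not0_implies_Suc
        add.right_neutral le_zero_eq not_less)
  then show ?thesis
  proof cases
    case 1
    then show ?thesis by (auto simp: hop_wt_def hop_wt'_def)
  next
    case 2
    then have "phi w (int x - int u + int i) * psi w (int u - int y - int j) = 0"
      by (cases "u \<le> x") (auto simp: phi_neg psi_neg)
    then show ?thesis by simp
  next
    case (3 n)
    have "chi n * (q - 1 / q ^ n) = chi (Suc n) * (s\<^sup>2 - 1 / q ^ n)"
    proof -
      have "chi n * (q - 1 / q ^ n) = - (chi n * (1 - q * q ^ n)) / q ^ n"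
        using q_nonzero by (simp add: field_simps)
      also have "\<dots> = chi (Suc n) * (s\<^sup>2 - 1 / q ^ n)"
        unfolding chi_Suc[symmetric] using q_nonzero by (simp add: field_simps)
      finally show ?thesis .
    qed
    then show ?thesis using 3 pw by (simp add: hop_wt_def hop_wt'_def)
  next
    case 4
    define n where "n = x - y"
    then have n: "int x - int y = int n" "x - y = n" "x + 1 - y = Suc n"
      using assms by auto
    have "chi (Suc n) * (1 / (q * q ^ n) - s\<^sup>2 / q) = chi n * (1 / (q * q ^ n) - 1)"
    proof -
      have "chi (Suc n) * (1 / (q * q ^ n) - s\<^sup>2 / q) = (chi (Suc n) * (1 - s\<^sup>2 * q ^ n)) / (q * q ^ n)"
        using q_nonzero by (simp add: field_simps)
      also have "\<dots> = chi n * (1 / (q * q ^ n) - 1)"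
        unfolding chi_Suc using q_nonzero by (simp add: field_simps)
      finally show ?thesis .
    qed
    then show ?thesis using 4 pw n by (simp add: hop_wt_def hop_wt'_def)
  qed
qed

text \<open>Peels one site off \<open>hop\<close> and \<open>branch\<close> together, with the
  exponent split as a + b to fit both local relations. The range up to \<open>Suc x\<close> serves i
  = 0 and i = 1 alike; the surplus term for i = 0 vanishes through \<open>phi\<close>.\<close>

lemma hop_branch_Cons:
  assumes "y \<le> x" "i \<le> 1"
  shows "hop z i (x # y # lam) (\<lambda>\<nu>. branch w \<nu> f) = chi (x - y) * (\<Sum>u\<le>Suc x. \<Sum>j\<le>1.
    hop_wt' z i j (int x - int u + (int u - int y)) * phi w (int x - int u + int i) *
      psi w (int u - int y - int j) * hop z j (y # lam) (\<lambda>\<nu>. branch w \<nu> (\<lambda>\<kappa>. f (u # \<kappa>))))"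
proof -
  let ?H = "\<lambda>j u. hop z j (y # lam) (\<lambda>\<nu>. branch w \<nu> (\<lambda>\<kappa>. f (u # \<kappa>)))"
  have step: "hop z j (y # lam) (\<lambda>\<nu>. branch w ((x + i) # \<nu>) f) = chi (x + i - (y + j)) *
      (\<Sum>u\<le>Suc x. phi w (int x - int u + int i) * psi w (int u - int y - int j) * ?H j u)" for j
  proof -
    have "{..x + i} \<subseteq> {..Suc x}" using assms by auto
    then have "(\<Sum>u\<le>x + i. phi w (int (x + i) - int u) * psi w (int u - int (y + j)) * X u) =
        (\<Sum>u\<le>Suc x. phi w (int x - int u + int i) * psi w (int u - int y - int j) * X u)" for X
      by (intro sum.mono_neutral_cong_left) (auto simp: phi_neg algebra_simps)
    then have "hop z j (y # lam) (\<lambda>\<nu>. branch w ((x + i) # \<nu>) f) =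
      hop z j (y # lam) (\<lambda>\<nu>. chi (x + i - (y + j)) *
        (\<Sum>u\<le>Suc x. phi w (int x - int u + int i) * psi w (int u - int y - int j) *
          branch w \<nu> (\<lambda>\<kappa>. f (u # \<kappa>))))"
      by (simp only: hop.simps branch.simps)
    then show ?thesis by (simp only: hop_mult hop_sum)
  qed
  have "hop z i (x # y # lam) (\<lambda>\<nu>. branch w \<nu> f) =
      (\<Sum>j\<le>1. hop_wt z i j (int x - int y) * hop z j (y # lam) (\<lambda>\<nu>. branch w ((x + i) # \<nu>) f))"
    by (subst hop.simps) simp
  also have "\<dots> = (\<Sum>j\<le>1. \<Sum>u\<le>Suc x. chi (x + i - (y + j)) * hop_wt z i j (int x - int y) *
      (phi w (int x - int u + int i) * psi w (int u - int y - int j)) * ?H j u)"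
    unfolding step sum_distrib_left by (simp only: mult_ac)
  also have "\<dots> = (\<Sum>j\<le>1. \<Sum>u\<le>Suc x. chi (x - y) * hop_wt' z i j (int x - int y) *
      (phi w (int x - int u + int i) * psi w (int u - int y - int j)) * ?H j u)"
    using assms by (intro sum.cong refl) (simp only: chi_hop_wt atMost_iff)
  also have "\<dots> = chi (x - y) * (\<Sum>u\<le>Suc x. \<Sum>j\<le>1.
    hop_wt' z i j (int x - int u + (int u - int y)) * phi w (int x - int u + int i) *
      psi w (int u - int y - int j) * ?H j u)"
    unfolding sum_distrib_left by (subst sum.swap) (simp add: mult_ac)
  finally show ?thesis .
qed

text \<open>At the last part the line leaves in state 0 and there is no \<open>psi\<close>; this is
  the base case of both inductions over the parts.\<close>

lemma chi_phi_hop_wt: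
  assumes "i \<le> 1"
  shows "chi (x + i) * hop_wt z i 0 (int x) * phi w (int x + int i) =
    chi x * exchange z w (int x) i 0 * phi w (int x)"
proof -
  from assms consider "i = 0" | "i = 1" by linarith
  then show ?thesis
  proof cases
    case 2
    have f: "phi w (int x + 1) * (1 - q * q ^ x) = (w + s * q ^ x) * phi w (int x)"
      using phi_rec[of w "int x"] q_nonzero by (simp add: power_int_add mult.commute)
    have "chi (Suc x) * (q powi (- int x - 1) - s\<^sup>2 / q) = (chi (Suc x) * (1 - s\<^sup>2 * q ^ x)) / (q * q ^ x)"
      using q_nonzero by (simp add: power_int_minus power_int_diff field_simps)
    also have "\<dots> = chi x * (1 - q * q ^ x) / (q * q ^ x)" by (simp only: chi_Suc)
    finally have "chi (Suc x) * (q powi (- int x - 1) - s\<^sup>2 / q) * phi w (int x + 1) =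
        chi x / (q * q ^ x) * (phi w (int x + 1) * (1 - q * q ^ x))"
      by simp
    also have "\<dots> = chi x * ((s + w * q powi (- int x)) / q) * phi w (int x)"
      unfolding f using q_nonzero by (simp add: power_int_minus field_simps)
    finally show ?thesis using 2 by (simp add: hop_wt_def exchange_def)
  qed (simp add: hop_wt_def exchange_def)
qed

text \<open>The one-site relation, iterated from the last part to the first, carries the exchange
  matrix across the whole partition.\<close>

lemma hop_branch:
  assumes "sorted_wrt (\<ge>) lam" "lam \<noteq> []" "i \<le> 1"
  shows "hop z i lam (\<lambda>\<nu>. branch w \<nu> f) =
    branch w lam (\<lambda>\<kappa>. \<Sum>j\<le>1. exchange z w (hd0 lam - hd0 \<kappa>) i j * hop z j \<kappa> f)"
  using assms(2,1,3)
proof (induction lam arbitrary: i f rule: list_nonempty_induct)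
  case (single x)
  have "hop z i [x] (\<lambda>\<nu>. branch w \<nu> f) = (chi (x + i) * hop_wt z i 0 (int x) * phi w (int x + int i)) * f []"
    by simp
  then show ?case unfolding chi_phi_hop_wt[OF \<open>i \<le> 1\<close>] by (simp add: mult_ac)
next
  case (cons x lam')
  then obtain y lam where lam': "lam' = y # lam" by (cases lam') auto
  have "y \<le> x" "sorted_wrt (\<ge>) (y # lam)" using cons.prems lam' by auto
  define S where "S j u = phi w (int x - int u + int j) * psi w (int u - int y - int j) *
    branch w (y # lam) (\<lambda>\<kappa>. exchange z w (int x - int u + int j) i j *
      (\<Sum>k\<le>1. hop_wt z j k (int u - int j - hd0 \<kappa>) * hop z k \<kappa> (\<lambda>\<kappa>. f (u # \<kappa>))))" for j u
  have inner: "(\<Sum>j\<le>1. hop_wt' z i j (int x - int u + (int u - int y)) * phi w (int x - int u + int i) *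
      psi w (int u - int y - int j) * hop z j (y # lam) (\<lambda>\<nu>. branch w \<nu> (\<lambda>\<kappa>. f (u # \<kappa>)))) =
    (\<Sum>j\<le>1. S j u)" (is "(\<Sum>j\<le>1. ?c j * ?L j) = _") for u
  proof -
    let ?h = "\<lambda>k \<kappa>. hop z k \<kappa> (\<lambda>\<kappa>. f (u # \<kappa>))"
    let ?d = "\<lambda>j. phi w (int x - int u + int j) * psi w (int u - int y - int j)"
    \<comment> \<open>The induction hypothesis moves \<open>hop\<close> inside \<open>branch\<close>
      on the tail; the one-site relation then applies for each inner tail \<kappa>, with v =
      \<open>hd0 \<kappa>\<close>.\<close>
    have pointwise: "(\<Sum>j\<le>1. ?c j * (\<Sum>k\<le>1. exchange z w (int y - v) j k * H k)) =
      (\<Sum>j\<le>1. ?d j * (exchange z w (int x - int u + int j) i j *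
        (\<Sum>k\<le>1. hop_wt z j k (int u - int j - v) * H k)))" for v and H :: "nat \<Rightarrow> complex"
    proof -
      have arg: "int u - int y - int j + (int y - v) = int u - int j - v" for j by simp
      have "(\<Sum>j\<le>1. ?c j * (\<Sum>k\<le>1. exchange z w (int y - v) j k * H k)) =
          (\<Sum>k\<le>1. (\<Sum>j\<le>1. ?c j * exchange z w (int y - v) j k) * H k)"
        unfolding sum_distrib_left sum_distrib_right by (subst sum.swap) (simp only: mult_ac)
      also have "\<dots> = (\<Sum>k\<le>1. (\<Sum>j\<le>1. ?d j * exchange z w (int x - int u + int j) i j *
          hop_wt z j k (int u - int y - int j + (int y - v))) * H k)"
        by (intro sum.cong refl arg_cong2[of _ _ _ _ "(*)"] local_intertwining) (use cons.prems in auto)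
      also have "\<dots> = (\<Sum>j\<le>1. ?d j * (exchange z w (int x - int u + int j) i j *
        (\<Sum>k\<le>1. hop_wt z j k (int u - int j - v) * H k)))"
        unfolding sum_distrib_left sum_distrib_right arg
        by (subst sum.swap) (simp only: mult_ac)
      finally show ?thesis .
    qed
    have "(\<Sum>j\<le>1. ?c j * ?L j) =
      (\<Sum>j\<le>1. ?c j * branch w (y # lam) (\<lambda>\<kappa>. \<Sum>k\<le>1. exchange z w (int y - hd0 \<kappa>) j k * ?h k \<kappa>))"
      using cons.IH[unfolded lam', OF \<open>sorted_wrt (\<ge>) (y # lam)\<close>] by (intro sum.cong refl) simp
    also have "\<dots> = (\<Sum>j\<le>1. S j u)"
      unfolding S_def branch_sum[symmetric] pointwise ..
    finally show ?thesis .
  qed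
  have "hop z i (x # y # lam) (\<lambda>\<nu>. branch w \<nu> f) = chi (x - y) * (\<Sum>u\<le>Suc x. \<Sum>j\<le>1. S j u)"
    unfolding hop_branch_Cons[OF \<open>y \<le> x\<close> \<open>i \<le> 1\<close>] inner ..
  \<comment> \<open>In \<open>S\<close> the index \<open>u\<close> is the inner part after the hop.
    Indexing by the part before the hop shifts the sum for j = 1 by one; the two boundary terms have
    a negative argument in \<open>phi\<close> or \<open>psi\<close>.\<close>
  also have "(\<Sum>u\<le>Suc x. \<Sum>j\<le>1. S j u) = (\<Sum>u\<le>x. S 0 u) + (\<Sum>u\<le>x. S 1 (Suc u))"
  proof -
    have "S 0 (Suc x) = 0" "S 1 0 = 0" by (simp_all add: S_def phi_neg psi_neg)
    then show ?thesis
      unfolding sum_le_1 sum.distrib sum.atMost_Suc[of "S 0"] sum.atMost_Suc_shift[of "S 1"] by simp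
  qed
  also have "\<dots> = (\<Sum>u\<le>x. phi w (int x - int u) * psi w (int u - int y) *
      branch w (y # lam) (\<lambda>\<kappa>. \<Sum>j\<le>1. exchange z w (int x - int u) i j * hop z j (u # \<kappa>) f))"
  proof -
    have "S 0 u = phi w (int x - int u) * psi w (int u - int y) *
        branch w (y # lam) (\<lambda>\<kappa>. exchange z w (int x - int u) i 0 * hop z 0 (u # \<kappa>) f)"
      and "S 1 (Suc u) = phi w (int x - int u) * psi w (int u - int y) *
        branch w (y # lam) (\<lambda>\<kappa>. exchange z w (int x - int u) i 1 * hop z 1 (u # \<kappa>) f)" for u
      by (simp_all add: S_def)
    then show ?thesis
      unfolding sum.distrib[symmetric] by (simp only: branch_sum branch_mult) (simp only: sum_le_1 distrib_left)
  qed
  finally show ?case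
    unfolding lam' by simp
qed

text \<open>By \<open>local_degeneration\<close> the vector \<open>(1, 1 / q)\<close> travels from
  the last part to the first, each site contributing \<open>w + s\<close> and replacing
  \<open>w\<close> by \<open>w / q\<close>.\<close>

lemma hop_branch_same_parameter:
  assumes "sorted_wrt (\<ge>) lam" "lam \<noteq> []" "i \<le> 1"
  shows "hop w i lam (\<lambda>\<nu>. branch w \<nu> f) = (1 / q) ^ i * (w + s) ^ length lam * branch (w / q) lam f"
  using assms(2,1,3)
proof (induction lam arbitrary: i f rule: list_nonempty_induct)
  case (single x)
  have "(chi (x + i) * hop_wt w i 0 (int x) * phi w (int x + int i)) =
      (1 / q) ^ i * (w + s) * (chi x * phi (w / q) (int x))"
  proof -
    have "exchange w w (int x) i 0 * phi w (int x) = (1 / q) ^ i * ((w + s) * phi (w / q) (int x))"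
    proof -
      consider "i = 0" | "i = 1" using \<open>i \<le> 1\<close> by linarith
      moreover have "s + w * q powi (- int x) = q powi (- int x) * (w + s * q powi int x)"
        using q_nonzero by (simp add: power_int_minus field_simps)
      ultimately show ?thesis
        by cases (simp_all add: phi_shift exchange_def)
    qed
    then show ?thesis
      unfolding chi_phi_hop_wt[OF \<open>i \<le> 1\<close>] by (simp add: mult_ac)
  qed
  moreover have "hop w i [x] (\<lambda>\<nu>. branch w \<nu> f) = (chi (x + i) * hop_wt w i 0 (int x) * phi w (int x + int i)) * f []"
    by simp
  ultimately show ?case by simp
next
  case (cons x lam')
  then obtain y lam where lam': "lam' = y # lam" by (cases lam') auto
  have "y \<le> x" "sorted_wrt (\<ge>) (y # lam)" using cons.prems lam' by auto
  note IH = cons.IH[unfolded lam', OF this(2)]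
  let ?N = "(w + s) ^ length (y # lam)"
  have "(\<Sum>j\<le>1. hop_wt' w i j (int x - int u + (int u - int y)) * phi w (int x - int u + int i) *
      psi w (int u - int y - int j) * hop w j (y # lam) (\<lambda>\<nu>. branch w \<nu> (\<lambda>\<kappa>. f (u # \<kappa>)))) =
    (1 / q) ^ i * (w + s) * ?N * (phi (w / q) (int x - int u) * psi (w / q) (int u - int y) *
      branch (w / q) (y # lam) (\<lambda>\<kappa>. f (u # \<kappa>)))" (is "(\<Sum>j\<le>1. ?c j * ?L j) = _") for u
  proof -
    have "(\<Sum>j\<le>1. ?c j * ?L j) = (\<Sum>j\<le>1. ?c j * (1 / q) ^ j) * (?N * branch (w / q) (y # lam) (\<lambda>\<kappa>. f (u # \<kappa>)))"
      unfolding sum_distrib_right using IH by (intro sum.cong refl) simp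
    then show ?thesis unfolding local_degeneration[OF \<open>i \<le> 1\<close>] by (simp add: mult_ac)
  qed
  then have "hop w i (x # y # lam) (\<lambda>\<nu>. branch w \<nu> f) = (1 / q) ^ i * (w + s) * ?N * (chi (x - y) *
      (\<Sum>u\<le>Suc x. phi (w / q) (int x - int u) * psi (w / q) (int u - int y) *
      branch (w / q) (y # lam) (\<lambda>\<kappa>. f (u # \<kappa>))))"
    unfolding hop_branch_Cons[OF \<open>y \<le> x\<close> \<open>i \<le> 1\<close>] by (simp only: sum_distrib_left mult_ac)
  then show ?case unfolding lam' by (simp add: phi_neg)
qed

text \<open>
  The common eigenvector \<open>(1, 1/q)\<close>, independent of \<open>a\<close> and \<open>w\<close>, is what propagates the relation
  \<open>A\<^sub>1 F = q^(-1) A\<^sub>0 F\<close> at \<open>z = \<theta>\<^sub>j\<close> through the later variables.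
\<close>

lemma exchange_eigenvector:
  assumes "i \<le> 1"
  shows "(\<Sum>j\<le>1. exchange z w a i j * (1 / q) ^ j) = (1 / q) ^ i * (z + s)"
proof -
  from assms consider "i = 0" | "i = 1" by linarith
  then show ?thesis using q_nonzero by cases (simp_all add: exchange_def field_simps)
qed

section \<open>Induction on the number of variables\<close>

text \<open>The polynomial in the normalization of \<open>branch\<close>: for l variables it is
  meant for lists of length l, which each branching shortens by one.\<close>

primrec norm_F :: "nat \<Rightarrow> (nat \<Rightarrow> complex) \<Rightarrow> nat list \<Rightarrow> complex" where
  "norm_F 0 \<theta> lam = 1"
| "norm_F (Suc l) \<theta> lam = branch (\<theta> l) lam (norm_F l \<theta>)"

lemma norm_F_Suc: "norm_F (Suc l) \<theta> = (\<lambda>\<nu>. branch (\<theta> l) \<nu> (norm_F l \<theta>))"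
  by (rule ext) simp

lemma norm_F_cong: "(\<And>j. j < l \<Longrightarrow> \<theta> j = \<eta> j) \<Longrightarrow> norm_F l \<theta> lam = norm_F l \<eta> lam"
proof (induction l arbitrary: lam)
  case (Suc l)
  then have "norm_F l \<theta> = norm_F l \<eta>" by (intro ext) simp
  then show ?case using Suc.prems by simp
qed simp

text \<open>For the last variable \<open>hop\<close> and \<open>branch\<close> have equal
  parameters. For an earlier one \<open>hop\<close> passes through the last branching, and the
  induction hypothesis supplies the eigenvector of the exchange matrix.\<close>

lemma hop_norm_F:
  assumes "sorted_wrt (\<ge>) lam" "length lam = l" "j < l" "i \<le> 1"
  shows "hop (\<theta> j) i lam (norm_F l \<theta>) =
    (1 / q) ^ i * (\<theta> j + s) ^ l * norm_F l (\<theta>(j := \<theta> j / q)) lam"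
  using assms
proof (induction l arbitrary: lam i)
  case (Suc l)
  have ne: "lam \<noteq> []" using Suc.prems by auto
  show ?case
  proof (cases "j = l")
    case True
    have "norm_F l (\<theta>(l := \<theta> l / q)) = norm_F l \<theta>" by (intro ext norm_F_cong) auto
    then have "norm_F (Suc l) (\<theta>(l := \<theta> l / q)) lam = branch (\<theta> l / q) lam (norm_F l \<theta>)"
      by (simp only: norm_F.simps fun_upd_same)
    then show ?thesis
      using hop_branch_same_parameter[OF Suc.prems(1) ne Suc.prems(4), of "\<theta> l" "norm_F l \<theta>"]
      by (simp only: True norm_F_Suc Suc.prems(2))
  next
    case False
    then have j: "j < l" using Suc.prems by simp
    let ?G = "norm_F l (\<theta>(j := \<theta> j / q))"
    have "hop (\<theta> j) i lam (norm_F (Suc l) \<theta>) = branch (\<theta> l) lam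
        (\<lambda>\<kappa>. \<Sum>k\<le>1. exchange (\<theta> j) (\<theta> l) (hd0 lam - hd0 \<kappa>) i k * hop (\<theta> j) k \<kappa> (norm_F l \<theta>))"
      unfolding norm_F_Suc by (rule hop_branch[OF Suc.prems(1) ne Suc.prems(4)])
    also have "\<dots> = branch (\<theta> l) lam (\<lambda>\<kappa>. ((1 / q) ^ i * (\<theta> j + s) ^ Suc l) * ?G \<kappa>)"
    proof (rule branch_cong[OF Suc.prems(1)])
      fix \<kappa> :: "nat list"
      assume \<kappa>: "Suc (length \<kappa>) = length lam" "sorted_wrt (\<ge>) \<kappa>"
      have "length \<kappa> = l" using \<kappa>(1) Suc.prems(2) by simp
      note IH = Suc.IH[OF \<kappa>(2) this j]
      have "(\<Sum>k\<le>1. exchange (\<theta> j) (\<theta> l) (hd0 lam - hd0 \<kappa>) i k * hop (\<theta> j) k \<kappa> (norm_F l \<theta>)) =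
        (\<Sum>k\<le>1. exchange (\<theta> j) (\<theta> l) (hd0 lam - hd0 \<kappa>) i k * (1 / q) ^ k) * ((\<theta> j + s) ^ l * ?G \<kappa>)"
        unfolding sum_distrib_right
        by (intro sum.cong refl) (simp only: IH atMost_iff mult.assoc)
      also have "\<dots> = ((1 / q) ^ i * (\<theta> j + s) ^ Suc l) * ?G \<kappa>"
        unfolding exchange_eigenvector[OF Suc.prems(4)] by (simp add: mult_ac)
      finally show "(\<Sum>k\<le>1. exchange (\<theta> j) (\<theta> l) (hd0 lam - hd0 \<kappa>) i k * hop (\<theta> j) k \<kappa> (norm_F l \<theta>)) =
        ((1 / q) ^ i * (\<theta> j + s) ^ Suc l) * ?G \<kappa>" .
    qed
    also have "\<dots> = (1 / q) ^ i * (\<theta> j + s) ^ Suc l * norm_F (Suc l) (\<theta>(j := \<theta> j / q)) lam"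
      using False by (simp add: branch_mult)
    finally show ?thesis .
  qed
qed simp

section \<open>Polynomial dependence on z and interpolation\<close>

text \<open>The state-1 polynomial has degree below the number of parts and enters state 0 with a
  factor z. So it affects neither the constant nor the leading coefficient; these are products of
  diagonal weights, whose exponents telescope.\<close>

lemma hop_poly:
  "\<exists>p. (\<forall>z. hop z 0 lam f = poly p z) \<and> degree p \<le> length lam \<and>
    coeff p 0 = s ^ length lam * f lam \<and> coeff p (length lam) = q powi (- hd0 lam) * f lam"
proof -
  \<comment> \<open>Bounding degrees by vanishing coefficients forces \<open>r = 0\<close> for the
    empty list.\<close>
  have "\<exists>p r. (\<forall>z. hop z 0 lam f = poly p z) \<and> (\<forall>z. hop z 1 lam f = poly r z) \<and>
    (\<forall>n>length lam. coeff p n = 0) \<and> (\<forall>n\<ge>length lam. coeff r n = 0) \<and>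
    coeff p 0 = s ^ length lam * f lam \<and> coeff p (length lam) = q powi (- hd0 lam) * f lam"
  proof (induction lam arbitrary: f)
    case Nil
    show ?case by (rule exI[of _ "[:f []:]"], rule exI[of _ 0]) (simp add: coeff_pCons split: nat.split)
  next
    case (Cons x lam)
    obtain p r where p: "\<And>z. hop z 0 lam (\<lambda>\<nu>. f (x # \<nu>)) = poly p z" "\<And>n. n > length lam \<Longrightarrow> coeff p n = 0"
        "coeff p 0 = s ^ length lam * f (x # lam)" "coeff p (length lam) = q powi (- hd0 lam) * f (x # lam)"
      and r: "\<And>z. hop z 1 lam (\<lambda>\<nu>. f (x # \<nu>)) = poly r z" "\<And>n. n \<ge> length lam \<Longrightarrow> coeff r n = 0"
      using Cons.IH[of "\<lambda>\<nu>. f (x # \<nu>)"] by auto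
    obtain p' r' where p': "\<And>z. hop z 0 lam (\<lambda>\<nu>. f (Suc x # \<nu>)) = poly p' z" "\<And>n. n > length lam \<Longrightarrow> coeff p' n = 0"
      and r': "\<And>z. hop z 1 lam (\<lambda>\<nu>. f (Suc x # \<nu>)) = poly r' z" "\<And>n. n \<ge> length lam \<Longrightarrow> coeff r' n = 0"
      using Cons.IH[of "\<lambda>\<nu>. f (Suc x # \<nu>)"] by auto
    define m where "m = int x - hd0 lam"
    define P where "P = [:s, q powi (- m):] * p + [:0, q - q powi (1 - m):] * r"
    define R where "R = smult (q powi (- m - 1) - s\<^sup>2 / q) p' - [:q powi (- m), s:] * r'"
    have "q powi (- m) * q powi (- hd0 lam) = q powi (- int x)"
      using q_nonzero by (simp add: m_def flip: power_int_add)
    then have "coeff P (length (x # lam)) = q powi (- hd0 (x # lam)) * f (x # lam)"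
      using p r by (simp add: P_def mult.assoc[symmetric])
    moreover have "coeff P 0 = s ^ length (x # lam) * f (x # lam)"
      using p by (simp add: P_def)
    moreover have "hop z 0 (x # lam) f = poly P z" "hop z 1 (x # lam) f = poly R z" for z
      using p r p' r' by (simp_all add: P_def R_def hop_wt_def m_def algebra_simps)
    moreover have "coeff P n = 0" if "n > length (x # lam)" for n
      using that p r by (cases n) (auto simp: P_def)
    moreover have "coeff R n = 0" if "n \<ge> length (x # lam)" for n
      using that p' r' by (cases n) (auto simp: R_def)
    ultimately show ?case by blast
  qed
  then show ?thesis by (metis degree_le)
qed

lemma norm_F_eigen:
  assumes "sorted_wrt (\<ge>) lam" "length lam = l"
    and nonzero: "\<And>j. j < l \<Longrightarrow> \<theta> j \<noteq> 0"
    and distinct: "\<And>i j. i < l \<Longrightarrow> j < l \<Longrightarrow> i \<noteq> j \<Longrightarrow> \<theta> i \<noteq> \<theta> j"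
  shows "E_op q s l (\<lambda>\<theta>. norm_F l \<theta> lam) \<theta> = q powi (- hd0 lam) * norm_F l \<theta> lam"
proof -
  obtain p where p: "\<forall>z. hop z 0 lam (norm_F l \<theta>) = poly p z" "degree p \<le> l"
    "coeff p 0 = s ^ l * norm_F l \<theta> lam" "coeff p l = q powi (- hd0 lam) * norm_F l \<theta> lam"
    using hop_poly[of lam "norm_F l \<theta>"] unfolding assms(2) by blast
  define S where "S = insert 0 (\<theta> ` {..<l})"
  have inj: "inj_on \<theta> {..<l}" using distinct by (auto simp: inj_on_def)
  have z: "0 \<notin> \<theta> ` {..<l}" using nonzero by auto
  have card: "card S = Suc l" and fin: "finite S"
    unfolding S_def using z by (simp_all add: card_image[OF inj])
  from p(2) have "coeff p l = (\<Sum>x\<in>S. poly p x / (\<Prod>y\<in>S - {x}. x - y))"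
    using coeff_lagrange[OF fin, of p] by (simp add: card)
  also have "\<dots> = poly p 0 / (\<Prod>y\<in>S - {0}. 0 - y) + (\<Sum>j<l. poly p (\<theta> j) / (\<Prod>y\<in>S - {\<theta> j}. \<theta> j - y))"
    unfolding S_def using z by (subst sum.insert) (auto simp: sum.reindex[OF inj])
  also have "poly p 0 / (\<Prod>y\<in>S - {0}. 0 - y) = (- s) ^ l / (\<Prod>j<l. \<theta> j) * norm_F l \<theta> lam"
  proof -
    have "S - {0} = \<theta> ` {..<l}" using z by (auto simp: S_def)
    then have "(\<Prod>y\<in>S - {0}. 0 - y) = (\<Prod>j<l. - \<theta> j)" by (simp add: prod.reindex[OF inj])
    also have "\<dots> = (- 1) ^ l * (\<Prod>j<l. \<theta> j)" by (simp add: prod_uminus)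
    finally show ?thesis
      using p(3) by (simp add: poly_0_coeff_0 power_minus[of s] divide_simps)
  qed
  also have "(\<Sum>j<l. poly p (\<theta> j) / (\<Prod>y\<in>S - {\<theta> j}. \<theta> j - y)) =
    (\<Sum>j<l. (1 + s / \<theta> j) ^ l * (\<Prod>i\<in>{..<l} - {j}. \<theta> j / (\<theta> j - \<theta> i)) * norm_F l (\<theta>(j := \<theta> j / q)) lam)"
  proof (rule sum.cong)
    fix j assume "j \<in> {..<l}"
    then have j: "j < l" by simp
    have "\<theta> ` ({..<l} - {j}) = \<theta> ` {..<l} - {\<theta> j}"
      using inj_on_image_set_diff[OF inj, of "{..<l}" "{j}"] j by simp
    then have "S - {\<theta> j} = insert 0 (\<theta> ` ({..<l} - {j}))"
      unfolding S_def using nonzero[OF j] by (simp add: insert_Diff_if)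
    moreover have "0 \<notin> \<theta> ` ({..<l} - {j})" using z by blast
    moreover have "inj_on \<theta> ({..<l} - {j})" using inj by (rule inj_on_subset) blast
    ultimately have den: "(\<Prod>y\<in>S - {\<theta> j}. \<theta> j - y) = \<theta> j * (\<Prod>i\<in>{..<l} - {j}. \<theta> j - \<theta> i)"
      by (simp add: prod.reindex)
    have coeff: "(\<Prod>i\<in>{..<l} - {j}. \<theta> j / (\<theta> j - \<theta> i)) =
        \<theta> j ^ (l - 1) / (\<Prod>i\<in>{..<l} - {j}. \<theta> j - \<theta> i)"
      using j by (simp add: prod_dividef card_Diff_singleton)
    have "1 + s / \<theta> j = (\<theta> j + s) / \<theta> j" using nonzero[OF j] by (simp add: add_divide_distrib)
    moreover have "\<theta> j ^ l = \<theta> j * \<theta> j ^ (l - 1)" using j by (cases l) auto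
    ultimately have pow: "(1 + s / \<theta> j) ^ l = (\<theta> j + s) ^ l / (\<theta> j * \<theta> j ^ (l - 1))"
      by (simp only: power_divide)
    have val: "poly p (\<theta> j) = (\<theta> j + s) ^ l * norm_F l (\<theta>(j := \<theta> j / q)) lam"
      using hop_norm_F[OF assms(1,2) j, of 0 \<theta>] p(1) by simp
    \<comment> \<open>Used with \<open>c\<close> equal to \<open>\<theta> j ^ (l - 1)\<close>, which
      supplies one numerator \<theta> j for each of the l - 1 differences.\<close>
    have cancel: "A * B / (t * d) = A / (t * c) * (c / d) * B" if "c \<noteq> 0" for A B t d c :: complex
      using that by simp
    show "poly p (\<theta> j) / (\<Prod>y\<in>S - {\<theta> j}. \<theta> j - y) =
      (1 + s / \<theta> j) ^ l * (\<Prod>i\<in>{..<l} - {j}. \<theta> j / (\<theta> j - \<theta> i)) * norm_F l (\<theta>(j := \<theta> j / q)) lam"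
      unfolding den coeff pow val by (rule cancel) (use nonzero[OF j] in simp)
  qed simp
  finally show ?thesis using p(4) by (simp add: E_op_def T_qinv_def)
qed

section \<open>Identification with the dual spin q-Whittaker polynomials\<close>

lemma phi_of_nat:
  assumes "w \<noteq> 0"
  shows "phi w (int n) = w ^ n * (qpoch (- s / w) q n / qpoch q q n)"
proof (induction n)
  case 0
  show ?case by (simp add: phi_def qpoch_def)
next
  case (Suc n)
  have "phi w (int (Suc n)) = phi w (int n) * ((w + s * q ^ n) / (1 - q ^ Suc n))"
    by (simp add: phi_def nat_add_distrib del: power_Suc)
  moreover have "w + s * q ^ n = w * (1 - - s / w * q ^ n)"
    using assms by (simp add: field_simps)
  ultimately show ?case using Suc.IH by (simp add: qpoch_Suc)
qed

lemma psi_of_nat: "psi w (int n) = qpoch (- s * w) q n / qpoch q q n"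
proof (induction n)
  case 0
  show ?case by (simp add: psi_def qpoch_def)
next
  case (Suc n)
  have "psi w (int (Suc n)) = psi w (int n) * ((1 + s * w * q ^ n) / (1 - q ^ Suc n))"
    by (simp add: psi_def nat_add_distrib del: power_Suc)
  then show ?case using Suc.IH by (simp add: qpoch_Suc)
qed

lemma chi_0: "chi 0 = 1"
  by (simp add: chi_def qpoch_def)

lemma chi_nonzero: "chi n \<noteq> 0"
proof (induction n)
  case (Suc n)
  have "chi n * (1 - q * q ^ n) \<noteq> 0" using Suc.IH q_not_root_of_unity[of "Suc n"] by auto
  then show ?case unfolding chi_Suc[symmetric] by auto
qed (simp add: chi_0)

lemma F1_factor_eq:
  assumes "w \<noteq> 0" "mu \<prec> lam"
  shows "F1_factor q s lam mu w k = phi w (int (lam k) - int (mu k)) *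
    psi w (int (mu k) - int (lam (Suc k))) * chi (mu k - mu (Suc k))"
proof -
  have "int (lam k) - int (mu k) = int (lam k - mu k)"
    "int (mu k) - int (lam (Suc k)) = int (mu k - lam (Suc k))"
    using assms(2) by (auto simp: interlaces_def of_nat_diff)
  then show ?thesis
    by (simp only: F1_factor_def phi_of_nat[OF assms(1)] psi_of_nat chi_def)
qed

lemma young_diagram_shift: "young_diagram lam \<Longrightarrow> young_diagram (\<lambda>k. lam (Suc k))"
  using finite_vimageI[of "{k. lam k \<noteq> 0}" Suc] by (auto simp: young_diagram_def vimage_def)

lemma young_diagram_eq_0:
  assumes "young_diagram lam" "lam l = 0" "l \<le> k"
  shows "lam k = 0"
proof -
  have "lam k \<le> lam l"
    by (rule lift_Suc_antimono_le) (use assms(1,3) in \<open>auto simp: young_diagram_def\<close>)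
  then show ?thesis using assms(2) by simp
qed

text \<open>Unrolls the recursion into one sum over interlacing diagrams. The last factor
  \<open>psi\<close> has argument 0, which is why \<open>branch\<close> has none for a single
  part.\<close>

lemma branch_eq_sum:
  assumes "young_diagram lam" "lam (Suc l) = 0"
  shows "branch w (map lam [0..<Suc l]) f = (\<Sum>\<kappa> | \<kappa> \<prec> lam \<and> \<kappa> l = 0.
    (\<Prod>k\<le>l. chi (lam k - lam (Suc k)) * phi w (int (lam k) - int (\<kappa> k)) *
      psi w (int (\<kappa> k) - int (lam (Suc k)))) * f (map \<kappa> [0..<l]))"
  using assms
proof (induction l arbitrary: lam f)
  case 0
  have "\<kappa> \<prec> lam \<and> \<kappa> 0 = 0 \<longleftrightarrow> \<kappa> = (\<lambda>_. 0)" for \<kappa>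
  proof
    assume \<kappa>: "\<kappa> \<prec> lam \<and> \<kappa> 0 = 0"
    have "\<kappa> k = 0" for k
    proof (cases k)
      case (Suc m)
      have "lam k = 0" using young_diagram_eq_0[OF 0, of k] Suc by simp
      then show ?thesis using \<kappa> by (metis interlaces_def le_zero_eq)
    qed (use \<kappa> in simp)
    then show "\<kappa> = (\<lambda>_. 0)" by (intro ext)
  next
    assume "\<kappa> = (\<lambda>_. 0)"
    moreover have "lam (Suc k) = 0" for k using young_diagram_eq_0[OF 0, of "Suc k"] by simp
    ultimately show "\<kappa> \<prec> lam \<and> \<kappa> 0 = 0" by (simp add: interlaces_def)
  qed
  then show ?case using 0 by (simp add: psi_def)
next
  case (Suc l)
  define lam' where "lam' k = lam (Suc k)" for k
  have lam': "young_diagram lam'" "lam' (Suc l) = 0"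
    using young_diagram_shift[OF Suc.prems(1)] Suc.prems(2) by (simp_all add: lam'_def[abs_def])
  define K where "K = {\<kappa>. \<kappa> \<prec> lam' \<and> \<kappa> l = 0}"
  let ?c = "\<lambda>lam \<kappa> k. chi (lam k - lam (Suc k)) * phi w (int (lam k) - int (\<kappa> k)) *
      psi w (int (\<kappa> k) - int (lam (Suc k)))"
  have list: "map lam [0..<Suc (Suc l)] = lam 0 # map lam' [0..<Suc l]"
    and list': "map lam' [0..<Suc l] = lam 1 # map (\<lambda>k. lam' (Suc k)) [0..<l]"
    unfolding lam'_def by (simp_all only: map_upt_Suc One_nat_def)
  have "branch w (map lam [0..<Suc (Suc l)]) f = chi (lam 0 - lam 1) *
    (\<Sum>u\<le>lam 0. phi w (int (lam 0) - int u) * psi w (int u - int (lam 1)) *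
      branch w (map lam' [0..<Suc l]) (\<lambda>\<kappa>. f (u # \<kappa>)))"
    unfolding list list' by simp
  also have "\<dots> = (\<Sum>u\<le>lam 0. chi (lam 0 - lam 1) * phi w (int (lam 0) - int u) * psi w (int u - int (lam 1)) *
      (\<Sum>\<kappa>\<in>K. (\<Prod>k\<le>l. ?c lam' \<kappa> k) * f (u # map \<kappa> [0..<l])))"
    unfolding Suc.IH[OF lam'] K_def by (simp only: sum_distrib_left mult.assoc)
  also have "\<dots> = (\<Sum>u\<in>{lam 1..lam 0}. chi (lam 0 - lam 1) * phi w (int (lam 0) - int u) * psi w (int u - int (lam 1)) *
      (\<Sum>\<kappa>\<in>K. (\<Prod>k\<le>l. ?c lam' \<kappa> k) * f (u # map \<kappa> [0..<l])))"
    by (rule sum.mono_neutral_right) (auto simp: psi_neg)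
  also have "\<dots> = (\<Sum>(u, \<kappa>)\<in>{lam 1..lam 0} \<times> K.
      (\<Prod>k\<le>Suc l. ?c lam (case_nat u \<kappa>) k) * f (map (case_nat u \<kappa>) [0..<Suc l]))"
  proof -
    have "(\<Prod>k\<le>Suc l. ?c lam (case_nat u \<kappa>) k) = chi (lam 0 - lam 1) * phi w (int (lam 0) - int u) *
        psi w (int u - int (lam 1)) * (\<Prod>k\<le>l. ?c lam' \<kappa> k)" for u \<kappa>
      unfolding prod.atMost_Suc_shift lam'_def by simp
    moreover have "map (case_nat u \<kappa>) [0..<Suc l] = u # map \<kappa> [0..<l]" for u and \<kappa> :: "nat \<Rightarrow> nat"
      by (simp only: map_upt_Suc nat.case)
    ultimately show ?thesis
      by (simp only: sum.cartesian_product[symmetric] sum_distrib_left mult.assoc)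
  qed
  also have "\<dots> = (\<Sum>\<kappa> | \<kappa> \<prec> lam \<and> \<kappa> (Suc l) = 0.
    (\<Prod>k\<le>Suc l. ?c lam \<kappa> k) * f (map \<kappa> [0..<Suc l]))"
  \<comment> \<open>A diagram corresponds to its first part and its shifted tail;
    \<open>case_nat\<close> glues them together.\<close>
  proof (rule sum.reindex_bij_witness[of _ "\<lambda>\<kappa>. (\<kappa> 0, \<lambda>k. \<kappa> (Suc k))" "\<lambda>(u, \<kappa>). case_nat u \<kappa>"])
    fix a assume "a \<in> {lam 1..lam 0} \<times> K"
    then show "(case a of (u, \<kappa>) \<Rightarrow> case_nat u \<kappa>) \<in> {\<kappa>. \<kappa> \<prec> lam \<and> \<kappa> (Suc l) = 0}"
      by (auto simp: K_def interlaces_def lam'_def split: nat.split)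
  next
    fix \<kappa> assume \<kappa>: "\<kappa> \<in> {\<kappa>. \<kappa> \<prec> lam \<and> \<kappa> (Suc l) = 0}"
    then show "(\<kappa> 0, \<lambda>k. \<kappa> (Suc k)) \<in> {lam 1..lam 0} \<times> K"
      by (auto simp: K_def interlaces_def lam'_def)
    show "(case (\<kappa> 0, \<lambda>k. \<kappa> (Suc k)) of (u, \<kappa>) \<Rightarrow> case_nat u \<kappa>) = \<kappa>"
      by (auto split: nat.split)
  qed auto
  finally show ?case .
qed

text \<open>Each variable accounts for at most one nonzero part, by interlacing.\<close>

lemma dual_spin_qW_eq_0:
  assumes "young_diagram lam" "lam l \<noteq> 0"
  shows "dual_spin_qW q s l lam \<theta> = 0"
  using assms
proof (induction l arbitrary: lam)
  case 0
  then show ?case by (auto simp: dual_spin_qW_def)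
next
  case (Suc l)
  have "F1 q s lam \<kappa> (\<theta> l) * F_skew q s l \<kappa> (\<lambda>_. 0) \<theta> = 0"
    if "young_diagram \<kappa>" "\<kappa> \<prec> lam" for \<kappa>
  proof -
    have "\<kappa> l \<noteq> 0" using that Suc.prems(2) by (metis interlaces_def le_zero_eq)
    then show ?thesis using Suc.IH[OF that(1)] by (simp add: dual_spin_qW_def)
  qed
  then show ?case unfolding dual_spin_qW_def F_skew.simps by (intro sum.neutral) auto
qed

text \<open>The factors \<open>chi\<close> telescope: those of the inner diagram, supplied by the
  induction hypothesis, are the ones in \<open>F1\<close>, and \<open>branch\<close> leaves those of
  the outer diagram.\<close>

lemma norm_F_eq_dual_spin_qW:
  assumes "young_diagram lam" "lam l = 0" "\<And>j. j < l \<Longrightarrow> \<theta> j \<noteq> 0"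
  shows "norm_F l \<theta> (map lam [0..<l]) = (\<Prod>k<l. chi (lam k - lam (Suc k))) * dual_spin_qW q s l lam \<theta>"
  using assms
proof (induction l arbitrary: lam)
  case 0
  have "lam = (\<lambda>_. 0)" using young_diagram_eq_0[OF 0(1,2)] by auto
  then show ?case by (simp add: dual_spin_qW_def)
next
  case (Suc l)
  let ?w = "\<theta> l"
  let ?P = "\<Prod>k\<le>l. chi (lam k - lam (Suc k))"
  have w: "?w \<noteq> 0" using Suc.prems(3) by simp
  have step: "(\<Prod>k\<le>l. chi (lam k - lam (Suc k)) * phi ?w (int (lam k) - int (\<kappa> k)) *
      psi ?w (int (\<kappa> k) - int (lam (Suc k)))) * norm_F l \<theta> (map \<kappa> [0..<l]) =
    ?P * (F1 q s lam \<kappa> ?w * F_skew q s l \<kappa> (\<lambda>_. 0) \<theta>)"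
    if \<kappa>: "\<kappa> \<prec> lam" "\<kappa> l = 0" for \<kappa>
  proof -
    have y: "young_diagram \<kappa>" using interlaces_young_diagram[OF Suc.prems(1) \<kappa>(1)] .
    have "F1_factor q s lam \<kappa> ?w k = 1" if "\<not> k \<le> l" for k
    proof -
      have "lam k = 0" "lam (Suc k) = 0" "\<kappa> k = 0" "\<kappa> (Suc k) = 0"
        using young_diagram_eq_0[OF Suc.prems(1,2)] young_diagram_eq_0[OF y \<kappa>(2)] that by auto
      then show ?thesis by (simp add: F1_factor_def qpoch_def)
    qed
    then have "F1 q s lam \<kappa> ?w = (\<Prod>k\<le>l. F1_factor q s lam \<kappa> ?w k)"
      using \<kappa>(1) unfolding F1_def by (subst Prod_any.expand_superset[of "{..l}"]) auto
    also have "\<dots> = (\<Prod>k\<le>l. phi ?w (int (lam k) - int (\<kappa> k)) * psi ?w (int (\<kappa> k) - int (lam (Suc k)))) *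
        (\<Prod>k\<le>l. chi (\<kappa> k - \<kappa> (Suc k)))"
      by (simp only: F1_factor_eq[OF w \<kappa>(1)] prod.distrib)
    \<comment> \<open>The factor at k = l is \<open>chi 0 = 1\<close>.\<close>
    also have "(\<Prod>k\<le>l. chi (\<kappa> k - \<kappa> (Suc k))) = (\<Prod>k<l. chi (\<kappa> k - \<kappa> (Suc k)))"
      using \<kappa>(2) by (simp add: chi_0 flip: lessThan_Suc_atMost)
    finally show ?thesis
      using Suc.IH[OF y \<kappa>(2)] Suc.prems(3) by (simp add: dual_spin_qW_def prod.distrib mult_ac)
  qed
  have fin: "finite {\<kappa>. young_diagram \<kappa> \<and> \<kappa> \<prec> lam}"
    by (rule finite_subset[OF _ finite_interlacing[OF Suc.prems(1)]]) auto
  have "norm_F (Suc l) \<theta> (map lam [0..<Suc l]) =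
      (\<Sum>\<kappa> | \<kappa> \<prec> lam \<and> \<kappa> l = 0. ?P * (F1 q s lam \<kappa> ?w * F_skew q s l \<kappa> (\<lambda>_. 0) \<theta>))"
    unfolding norm_F.simps branch_eq_sum[OF Suc.prems(1,2)] by (intro sum.cong refl step) auto
  \<comment> \<open>The added \<kappa> have more than l parts, so their polynomial in l variables
    vanishes.\<close>
  also have "\<dots> = (\<Sum>\<kappa> | young_diagram \<kappa> \<and> \<kappa> \<prec> lam. ?P * (F1 q s lam \<kappa> ?w * F_skew q s l \<kappa> (\<lambda>_. 0) \<theta>))"
    using dual_spin_qW_eq_0 interlaces_young_diagram[OF Suc.prems(1)] fin
    by (intro sum.mono_neutral_left) (auto simp: dual_spin_qW_def)
  also have "\<dots> = ?P * dual_spin_qW q s (Suc l) lam \<theta>"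
    by (simp add: dual_spin_qW_def sum_distrib_left)
  finally show ?case by (simp only: lessThan_Suc_atMost)
qed

lemma dual_spin_qW_eigen:
  assumes "young_diagram lam" "1 \<le> l"
    and nonzero: "\<And>j. j < l \<Longrightarrow> \<theta> j \<noteq> 0"
    and distinct: "\<And>i j. i < l \<Longrightarrow> j < l \<Longrightarrow> i \<noteq> j \<Longrightarrow> \<theta> i \<noteq> \<theta> j"
  shows "E_op q s l (dual_spin_qW q s l lam) \<theta> = inverse q ^ lam 0 * dual_spin_qW q s l lam \<theta>"
proof (cases "lam l = 0")
  case False
  \<comment> \<open>With more than l parts the polynomial is zero at \<theta> and at all shifted
    points.\<close>
  then show ?thesis by (simp add: E_op_def T_qinv_def dual_spin_qW_eq_0[OF assms(1)])
next
  case True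
  define P where "P = (\<Prod>k<l. chi (lam k - lam (Suc k)))"
  let ?lam = "map lam [0..<l]"
  have "P \<noteq> 0" by (simp add: P_def chi_nonzero)
  have G: "norm_F l \<eta> ?lam = P * dual_spin_qW q s l lam \<eta>" if "\<And>j. j < l \<Longrightarrow> \<eta> j \<noteq> 0" for \<eta>
    unfolding P_def by (rule norm_F_eq_dual_spin_qW[OF assms(1) True that])
  \<comment> \<open>Dividing a variable by \<open>q\<close> keeps it nonzero, so proportionality
    with the constant \<open>P\<close> holds at every point where \<open>E_op\<close> evaluates its
    argument.\<close>
  have T: "norm_F l (\<theta>(j := \<theta> j / q)) ?lam = P * dual_spin_qW q s l lam (\<theta>(j := \<theta> j / q))" if "j < l" for j
    using nonzero that q_nonzero by (intro G) auto
  have "antimono lam" using assms(1) by (simp add: young_diagram_def antimono_iff_le_Suc)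
  then have "sorted_wrt (\<ge>) ?lam"
    by (auto simp: sorted_wrt_iff_nth_less antimono_def)
  moreover have "hd0 ?lam = int (lam 0)" using assms(2) by (simp add: upt_conv_Cons)
  ultimately have "E_op q s l (\<lambda>\<theta>. norm_F l \<theta> ?lam) \<theta> = q powi (- int (lam 0)) * norm_F l \<theta> ?lam"
    using norm_F_eigen[of ?lam l \<theta>] nonzero distinct by simp
  moreover have "E_op q s l (\<lambda>\<theta>. norm_F l \<theta> ?lam) \<theta> = P * E_op q s l (dual_spin_qW q s l lam) \<theta>"
    unfolding E_op_def T_qinv_def using T G[OF nonzero]
    by (simp add: distrib_left sum_distrib_left mult_ac)
  ultimately show ?thesis
    using \<open>P \<noteq> 0\<close> G[OF nonzero] by (simp add: power_int_minus power_inverse)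
qed

end

theorem theorem1p2:
  fixes q :: real and s :: complex and l :: nat
    and lam :: "nat \<Rightarrow> nat" and \<theta> :: "nat \<Rightarrow> complex"
  assumes "0 < q" and "q < 1"
    and s_generic: "\<And>k. s\<^sup>2 * complex_of_real q ^ k \<noteq> 1"
    and "young_diagram lam"
    and "1 \<le> l"
    and nonzero: "\<And>j. j < l \<Longrightarrow> \<theta> j \<noteq> 0"
    and distinct: "\<And>i j. i < l \<Longrightarrow> j < l \<Longrightarrow> i \<noteq> j \<Longrightarrow> \<theta> i \<noteq> \<theta> j"
  shows "E_op (complex_of_real q) s l (dual_spin_qW (complex_of_real q) s l lam) \<theta> =
         inverse (complex_of_real q) ^ lam 0 * dual_spin_qW (complex_of_real q) s l lam \<theta>"
proof -
  have "complex_of_real q ^ n \<noteq> 1" if "0 < n" for n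
  proof -
    have "q ^ n < 1" using assms(1,2) that by (simp add: power_less_one_iff)
    then show ?thesis by (metis less_irrefl of_real_eq_1_iff of_real_power)
  qed
  then interpret spin_parameters "complex_of_real q" s
    using assms(1) s_generic by unfold_locales auto
  show ?thesis using assms(4-7) by (rule dual_spin_qW_eigen)
qed

end
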